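(* Let $A=\mathbb{F}_2[x,y]/(y^2+y+x^3+x+1)$, and let $d_k$, $\ell_k$ be the (inverse) coefficients of the normalized exponential and logarithm of the Drinfeld $A$-module $\rho$, and $D_k$ the product of all elements of $A$ of degree $k$. Then: 1) $d_2=D_2$. 2) For all $k\ge2$, $$d_k=\frac{D_kd_{k-1}}{d_{k-1}+D_k}\left(1+D_k+D_{k-1}^2+\cdots+D_2^{2^{k-2}}\right),$$ where the sum in parentheses is $1+\sum_{i=2}^{k}D_i^{2^{k-i}}$. 3) For all $k\ge2$, $$\ell_k=\frac{D_kd_k}{(d_k+D_k^2)\,(D_{k-1}D_{k-2}\cdots D_2)},$$ where the product $D_{k-1}D_{k-2}\cdots D_2$ is $1$ if $k=2$.
   Context: Let $A=\mathbb{F}_2[x,y]/(y^2+y+x^3+x+1)$, with fraction field $K$. The degree function on $A$ is the one given by the place at infinity: $\deg(x)=2$, $\deg(y)=3$. That is, $A$ has $\mathbb{F}_2$-basis $\{x^i, yx^i : i\ge 0\}$ with $\deg(x^i)=2i$ and $\deg(yx^i)=2i+3$; the degree of a nonzero element is the maximum of the degrees of the basis elements occurring in it, and $\deg 0=-\infty$. Let $\tau$ be the Frobenius $z\mapsto z^2$, so a twisted polynomial $\sum_i c_i\tau^i$ acts by $z\mapsto\sum_i c_i z^{2^i}$ and $\tau c=c^2\tau$. The Drinfeld $A$-module $\rho$ is the $\mathbb{F}_2$-algebra homomorphism from $A$ to twisted polynomials determined by $$\rho_x=x+(x^2+x)\tau+\tau^2,\qquad \rho_y=y+(y^2+y)\tau+x(y^2+y)\tau^2+\tau^3.$$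 Its normalized exponential is the unique power series $e(z)=\sum_{i\ge0}z^{2^i}/d_i=\sum_{i\ge 0}a_iz^{2^i}$ over $K$ with $d_0=1$ satisfying $e(xz)=\rho_x(e(z))=x\,e(z)+(x^2+x)e(z)^2+e(z)^4$. The normalized logarithm $\log(z)=\sum_{i\ge0}z^{2^i}/\ell_i=\sum_{i\ge0} b_iz^{2^i}$ (with $\ell_0=1$) is the formal compositional inverse of $e(z)$. Here $a_i=d_i^{-1}$ and $b_i=\ell_i^{-1}$. Equivalently, with $[j]_x=x^{2^j}+x$: $a_0=a_1=1$ and $a_j=([1]_xa_{j-1}^2+a_{j-2}^4)/[j]_x$ for $j\ge2$; $b_0=b_1=1$ and $b_j=([1]_x^{2^{j-1}}b_{j-1}+b_{j-2})/[j]_x$ for $j\ge 2$. For $k\ge2$, $D_k=\prod_{a\in A,\ \deg(a)=k}a$ (every nonzero element is monic since the constant field is $\mathbb{F}_2$). Equivalently $D_k=e_k(t_k)$, where $e_k(w)=\prod_{a\in A,\ \deg(a)<k}(w+a)$ (the product including $a=0$) and $t_k=x^{k/2}$ for $k$ even, $t_k=yx^{(k-3)/2}$ for $k$ odd. *)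

theory Defs
  imports
    "HOL-Library.Z2"
    "HOL-Library.Extended_Real"
    "HOL-Computational_Algebra.Computational_Algebra"
begin

declare add_bit_eq_xor [simp del] mult_bit_eq_and [simp del]

lifting_forget poly.lifting

section \<open>The coordinate ring and its fraction field\<close>

text \<open>
  \<^typ>\<open>bit\<close> is the field with two elements, and \<^typ>\<open>bit poly poly\<close> is F2[x][y]:
  the inner polynomial variable is x, the outer one is y.
\<close>

definition curve_poly :: "bit poly poly" where
  "curve_poly = [:[:1, 1, 0, 1:], 1, 1:]"  \<comment> \<open>y^2 + y + (x^3 + x + 1)\<close>

definition curve_cong :: "bit poly poly \<Rightarrow> bit poly poly \<Rightarrow> bool" where
  "curve_cong p q \<longleftrightarrow> curve_poly dvd p - q"

lemma equivp_curve_cong: "equivp curve_cong"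
proof (rule equivpI)
  show "reflp curve_cong"
    by (simp add: reflp_def curve_cong_def)
  show "symp curve_cong"
    unfolding symp_def curve_cong_def by (metis dvd_minus_iff minus_diff_eq)
  show "transp curve_cong"
    unfolding transp_def curve_cong_def by (metis dvd_add diff_add_cancel add_diff_eq)
qed

quotient_type coord_ring = "bit poly poly" / curve_cong
  by (rule equivp_curve_cong)

instantiation coord_ring :: comm_ring
begin

lift_definition zero_coord_ring :: coord_ring is 0 .

lift_definition plus_coord_ring :: "coord_ring \<Rightarrow> coord_ring \<Rightarrow> coord_ring" is "(+)"
  unfolding curve_cong_def by (metis add_diff_add dvd_add)

lift_definition uminus_coord_ring :: "coord_ring \<Rightarrow> coord_ring" is uminus
  unfolding curve_cong_def by (metis dvd_minus_iff minus_diff_minus)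

lift_definition minus_coord_ring :: "coord_ring \<Rightarrow> coord_ring \<Rightarrow> coord_ring" is "(-)"
proof -
  fix p p' q q'
  assume "curve_cong p p'" "curve_cong q q'"
  moreover have "(p - q) - (p' - q') = (p - p') - (q - q')"
    by simp
  ultimately show "curve_cong (p - q) (p' - q')"
    unfolding curve_cong_def by (metis dvd_diff)
qed

lift_definition times_coord_ring :: "coord_ring \<Rightarrow> coord_ring \<Rightarrow> coord_ring" is "(*)"
proof -
  fix p p' q q'
  assume "curve_cong p p'" "curve_cong q q'"
  moreover have "p * q - p' * q' = (p - p') * q + p' * (q - q')"
    by (simp add: algebra_simps)
  ultimately show "curve_cong (p * q) (p' * q')"
    unfolding curve_cong_def by (metis dvd_add dvd_mult dvd_mult2)
qed

instance
proof
  fix a b c :: coord_ring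
  show "a * b * c = a * (b * c)" "a * b = b * a" "a + b + c = a + (b + c)" "a + b = b + a"
    "0 + a = a" "- a + a = 0" "a - b = a + - b" "(a + b) * c = a * c + b * c"
    by (transfer; simp add: algebra_simps curve_cong_def)+
qed

end

lemma dvd_curve_degree_le_1:
  assumes "curve_poly dvd [:a, b:]"
  shows "a = 0 \<and> b = 0"
proof -
  have "degree curve_poly = 2" by (simp add: curve_poly_def)
  moreover have "degree [:a, b:] \<le> 1" by simp
  ultimately have "\<not> degree curve_poly \<le> degree [:a, b:]" by linarith
  hence "[:a, b:] = 0"
    using dvd_imp_degree_le[OF assms] by (rule contrapos_np)
  thus ?thesis by simp
qed

instantiation coord_ring :: comm_ring_1
begin

lift_definition one_coord_ring :: coord_ring is 1 .

instance
proof
  fix a :: coord_ring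
  show "1 * a = a" by transfer (simp add: curve_cong_def)
  show "(0::coord_ring) \<noteq> 1"
  proof (transfer, rule notI)
    assume "curve_cong 0 1"
    hence "curve_poly dvd [:-1, 0:]" by (simp add: curve_cong_def one_pCons)
    from dvd_curve_degree_le_1[OF this] show False by simp
  qed
qed

end

text \<open>\<open>elt a b\<close> is the class of a(x) + b(x) y.\<close>

lift_definition elt :: "bit poly \<Rightarrow> bit poly \<Rightarrow> coord_ring" is "\<lambda>a b. [:a, b:]" .

text \<open>The monomials x^i, y x^i form an F2-basis of the coordinate ring.\<close>

lemma elt_inject: "elt a b = elt c d \<longleftrightarrow> a = c \<and> b = d"
proof
  assume "elt a b = elt c d"
  hence "curve_poly dvd [:a - c, b - d:]"
    by transfer (simp add: curve_cong_def)
  from dvd_curve_degree_le_1[OF this] show "a = c \<and> b = d" by simp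
qed simp

lemma elt_surj: "\<exists>a b. u = elt a b"
proof transfer
  fix p
  show "\<exists>a b. curve_cong p [:a, b:]"
  proof (induction p)
    case 0
    show ?case by (intro exI[of _ 0]) (simp add: curve_cong_def)
  next
    case (pCons h p)
    then obtain a b where "curve_poly dvd p - [:a, b:]"
      by (auto simp: curve_cong_def)
    hence "curve_poly dvd [:0, 1:] * (p - [:a, b:]) + curve_poly * [:b:]"
      by (intro dvd_add dvd_mult dvd_triv_left)
    also have "[:0, 1:] * (p - [:a, b:]) + curve_poly * [:b:]
        = pCons h p - [:h - b * [:1, 1, 0, 1:], a - b:]"
      by (simp add: curve_poly_def algebra_simps diff_pCons)
    finally show ?case unfolding curve_cong_def by blast
  qed
qed


lemma two_bit_poly: "p + p = 0" for p :: "bit poly"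
  by (rule poly_eqI) (metis coeff_0 coeff_add add.right_inverse uminus_bit_def id_apply)

lemma two_bit_poly': "(2 :: bit poly) = 0"
  using two_bit_poly[of 1] by simp

lemma uminus_bit_poly: "- p = p" for p :: "bit poly"
  using two_bit_poly[of p] by (metis add_eq_0_iff)

lemma minus_bit_poly: "p - q = p + q" for p q :: "bit poly"
  by (metis diff_conv_add_uminus uminus_bit_poly)

lemma elt_add: "elt a b + elt c d = elt (a + c) (b + d)"
  by transfer (simp add: curve_cong_def)

lemma elt_mult:
  "elt a b * elt c d = elt (a * c + b * d * [:1, 1, 0, 1:]) (a * d + b * c + b * d)"
proof transfer
  fix a b c d :: "bit poly"
  have "[:a, b:] * [:c, d:] - [:a * c + b * d * [:1, 1, 0, 1:], a * d + b * c + b * d:]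
      = [:- (b * d * [:1, 1, 0, 1:]), - (b * d), b * d:]"
    by (simp add: algebra_simps)
  also have "\<dots> = [:b * d * [:1, 1, 0, 1:], b * d, b * d:]"
    unfolding uminus_bit_poly ..
  also have "\<dots> = curve_poly * [:b * d:]"
    by (simp add: curve_poly_def)
  finally show "curve_cong ([:a, b:] * [:c, d:])
     [:a * c + b * d * [:1, 1, 0, 1:], a * d + b * c + b * d:]"
    unfolding curve_cong_def by (simp only: dvd_triv_left)
qed

lemma elt_0: "elt 0 0 = 0" by transfer (simp add: curve_cong_def)
lemma elt_1: "elt 1 0 = 1" by transfer (simp add: curve_cong_def one_pCons)

lemma curve_norm_nonzero:
  fixes a b :: "bit poly"
  assumes "a * a + a * b + b * b * [:1, 1, 0, 1:] = 0"
  shows "a = 0 \<and> b = 0"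
proof (rule ccontr)
  assume n: "\<not> (a = 0 \<and> b = 0)"
  have df: "degree ([:1, 1, 0, 1:] :: bit poly) = 3" by simp
  have b: "b \<noteq> 0" using n assms by auto
  have eq: "a * (a + b) = b * b * [:1, 1, 0, 1:]"
    using assms by (simp add: distrib_left add_eq_0_iff uminus_bit_poly)
  have "b * b * [:1, 1, 0, 1:] \<noteq> 0"
    unfolding mult_eq_0_iff using b by simp
  hence a: "a \<noteq> 0" and ab: "a + b \<noteq> 0"
    unfolding eq[symmetric] mult_eq_0_iff by simp_all
  have deg: "degree a + degree (a + b) = 2 * degree b + 3"
    using arg_cong[OF eq, of degree] a b ab
    by (simp add: degree_mult_eq df del: mult_pCons_left mult_pCons_right)
  show False
  proof (cases "degree a \<le> degree b")
    case True
    hence "degree (a + b) \<le> degree b" by (intro degree_add_le) auto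
    with deg True show False by linarith
  next
    case False
    hence "degree (a + b) = degree a" by (intro degree_add_eq_left) auto
    with deg show False by presburger
  qed
qed

instance coord_ring :: idom
proof
  fix u v :: coord_ring
  assume u: "u \<noteq> 0" and v: "v \<noteq> 0"
  obtain a b where ab: "u = elt a b" using elt_surj by blast
  obtain c d where cd: "v = elt c d" using elt_surj by blast
  define n where "n = a * a + a * b + b * b * [:1, 1, 0, 1:]"
  have n: "n \<noteq> 0"
    unfolding n_def using curve_norm_nonzero[of a b] u ab elt_0 by metis
  show "u * v \<noteq> 0"
  proof
    assume "u * v = 0"
    hence "elt (a + b) b * u * v = 0" by (simp add: mult.assoc)
    moreover have "elt (a + b) b * u = elt n 0"
      unfolding ab elt_mult elt_inject n_def
      by (simp add: algebra_simps two_bit_poly two_bit_poly' del: mult_pCons_left mult_pCons_right)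
    ultimately have "elt (n * c) (n * d) = elt 0 0"
      by (simp add: cd elt_mult elt_0)
    hence "c = 0 \<and> d = 0" unfolding elt_inject using n by simp
    with v cd elt_0 show False by simp
  qed
qed

type_synonym function_field = "coord_ring fract"

definition xA :: coord_ring where "xA = elt [:0, 1:] 0"
definition yA :: coord_ring where "yA = elt 0 1"

abbreviation xK :: function_field where "xK \<equiv> to_fract xA"
abbreviation yK :: function_field where "yK \<equiv> to_fract yA"

lemma curve_equation: "yA ^ 2 + yA + xA ^ 3 + xA + 1 = 0"
  by (simp add: xA_def yA_def elt_mult elt_add elt_inject power2_eq_square power3_eq_cube
      one_pCons two_bit_poly' two_bit_poly flip: elt_0 elt_1)

lemma two_coord_ring: "u + u = 0" for u :: coord_ring
proof -
  obtain a b where u: "u = elt a b" using elt_surj by blast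
  show ?thesis unfolding u elt_add two_bit_poly elt_0 ..
qed

lemma two_function_field: "u + u = 0" for u :: function_field
proof -
  have "(1 :: function_field) + 1 = 0"
    using two_coord_ring[of 1] by (metis to_fract_0 to_fract_1 to_fract_add)
  thus ?thesis by (metis distrib_left mult_1_right mult_zero_right)
qed

lemma CHAR_function_field: "CHAR(function_field) = 2"
proof (rule CHAR_eq_posI)
  show "of_nat 2 = (0 :: function_field)" using two_function_field[of 1] by simp
next
  fix m :: nat assume "0 < m" "m < 2"
  hence "m = 1" by simp
  thus "of_nat m \<noteq> (0 :: function_field)" by simp
qed simp


section \<open>The degree and the products of elements of fixed degree\<close>

text \<open>
  The degrees of the basis elements x^i, y x^i occurring in an element. The degree is their
  maximum, with degree minus infinity for the zero element, as \<open>Sup {} = -\<infinity>\<close> in \<^typ>\<open>ereal\<close>.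
\<close>

definition basis_degrees :: "coord_ring \<Rightarrow> nat set" where
  "basis_degrees u = {n. \<exists>a b i. u = elt a b \<and>
     (coeff a i \<noteq> 0 \<and> n = 2 * i \<or> coeff b i \<noteq> 0 \<and> n = 2 * i + 3)}"

definition degA :: "coord_ring \<Rightarrow> ereal" where
  "degA u = (SUP n\<in>basis_degrees u. ereal (real n))"

definition deg_prod :: "nat \<Rightarrow> function_field" where
  "deg_prod k = to_fract (\<Prod>u\<in>{u. degA u = ereal (real k)}. u)"

lemma finite_basis_degrees: "finite (basis_degrees u)"
proof -
  obtain a b where u: "u = elt a b" using elt_surj by blast
  have "basis_degrees u \<subseteq> {..2 * degree a + 2 * degree b + 3}"
    unfolding basis_degrees_def u elt_inject
    using le_degree[of a] le_degree[of b] by fastforce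
  thus ?thesis by (rule finite_subset) simp
qed

lemma degA_0: "degA 0 = - \<infinity>"
proof -
  have "basis_degrees 0 = {}"
    by (auto simp: basis_degrees_def elt_inject simp flip: elt_0)
  thus ?thesis by (simp add: degA_def bot_ereal_def)
qed

lemma basis_degrees_nonempty: "u \<noteq> 0 \<Longrightarrow> basis_degrees u \<noteq> {}"
proof -
  assume "u \<noteq> 0"
  obtain a b where u: "u = elt a b" using elt_surj by blast
  with \<open>u \<noteq> 0\<close> elt_0 have "a \<noteq> 0 \<or> b \<noteq> 0" by auto
  hence "coeff a (degree a) \<noteq> 0 \<or> coeff b (degree b) \<noteq> 0"
    by (metis leading_coeff_0_iff)
  thus ?thesis unfolding basis_degrees_def u by blast
qed

lemma degA_eq_Max: "u \<noteq> 0 \<Longrightarrow> degA u = ereal (real (Max (basis_degrees u)))"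
  unfolding degA_def
  by (rule antisym)
    (auto intro!: SUP_least SUP_upper Max_in simp: finite_basis_degrees basis_degrees_nonempty)

lemma finite_bit_poly_degree_le: "finite {p :: bit poly. degree p \<le> n}"
proof (induction n)
  case 0
  have "{p :: bit poly. degree p \<le> 0} \<subseteq> {0, 1}"
    by (auto elim!: degree_eq_zeroE simp: one_pCons)
  thus ?case by (rule finite_subset) simp
next
  case (Suc n)
  have "{p :: bit poly. degree p \<le> Suc n}
      \<subseteq> (\<lambda>(c, q). pCons c q) ` ({0, 1} \<times> {p. degree p \<le> n})"
  proof
    fix p :: "bit poly" assume p: "p \<in> {p. degree p \<le> Suc n}"
    obtain c q where cq: "p = pCons c q" by (cases p)
    have "degree q \<le> n" using p by (cases "q = 0") (auto simp: cq)
    moreover have "c \<in> {0, 1}" by (cases c) auto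
    ultimately show "p \<in> (\<lambda>(c, q). pCons c q) ` ({0, 1} \<times> {p. degree p \<le> n})"
      unfolding cq by blast
  qed
  thus ?case by (rule finite_subset) (use Suc in simp)
qed

lemma finite_degA_eq: "finite {u. degA u = ereal (real k)}"
proof -
  have "{u. degA u = ereal (real k)}
      \<subseteq> (\<lambda>(a, b). elt a b) ` ({p. degree p \<le> k} \<times> {p. degree p \<le> k})"
  proof
    fix u assume "u \<in> {u. degA u = ereal (real k)}"
    hence k: "degA u = ereal (real k)" by simp
    obtain a b where u: "u = elt a b" using elt_surj by blast
    have bound: "n \<le> k" if "n \<in> basis_degrees u" for n
    proof -
      have "ereal (real n) \<le> degA u"
        unfolding degA_def using that by (rule SUP_upper)
      thus ?thesis using k by simp
    qed
    have "degree a \<le> k"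
    proof (cases "a = 0")
      case False
      hence "coeff a (degree a) \<noteq> 0" by (metis leading_coeff_0_iff)
      hence "2 * degree a \<in> basis_degrees u"
        unfolding basis_degrees_def u by blast
      from bound[OF this] show ?thesis by simp
    qed simp
    moreover have "degree b \<le> k"
    proof (cases "b = 0")
      case False
      hence "coeff b (degree b) \<noteq> 0" by (metis leading_coeff_0_iff)
      hence "2 * degree b + 3 \<in> basis_degrees u"
        unfolding basis_degrees_def u by blast
      from bound[OF this] show ?thesis by simp
    qed simp
    ultimately show "u \<in> (\<lambda>(a, b). elt a b) ` ({p. degree p \<le> k} \<times> {p. degree p \<le> k})"
      unfolding u by blast
  qed
  thus ?thesis by (rule finite_subset) (simp add: finite_bit_poly_degree_le)
qed


section \<open>Twisted polynomials\<close>

text \<open>The polynomial with coefficients c_i represents the sum of the c_i \<tau>^i.\<close>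

typedef twisted = "UNIV :: function_field poly set" ..

definition tcoeff :: "twisted \<Rightarrow> nat \<Rightarrow> function_field" where
  "tcoeff p = coeff (Rep_twisted p)"

definition tdegree :: "twisted \<Rightarrow> nat" where
  "tdegree p = degree (Rep_twisted p)"

definition tpoly :: "function_field list \<Rightarrow> twisted" where
  "tpoly cs = Abs_twisted (Poly cs)"

lemma tcoeff_tpoly [simp]: "tcoeff (tpoly cs) i = nth_default 0 cs i"
  by (simp add: tcoeff_def tpoly_def Abs_twisted_inverse)

lemma twisted_eqI: "(\<And>n. tcoeff p n = tcoeff q n) \<Longrightarrow> p = q"
  unfolding tcoeff_def by (metis Rep_twisted_inject poly_eqI)

text \<open>As \<open>\<tau> c = c^2 \<tau>\<close>, we have \<open>(a \<tau>^i) (b \<tau>^j) = a b^(2^i) \<tau>^(i+j)\<close>.\<close>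

definition twisted_mult ::
    "function_field poly \<Rightarrow> function_field poly \<Rightarrow> function_field poly" where
  "twisted_mult p q =
     (\<Sum>i\<le>degree p. \<Sum>j\<le>degree q. monom (coeff p i * coeff q j ^ 2 ^ i) (i + j))"

lemma power_2_power_add: "(a + b) ^ 2 ^ n = a ^ 2 ^ n + b ^ 2 ^ n" for a b :: function_field
  by (rule freshmans_dream') (simp_all add: CHAR_function_field)

lemma power_2_power_sum: "sum f A ^ 2 ^ n = (\<Sum>i\<in>A. f i ^ 2 ^ n)"
  for f :: "'a \<Rightarrow> function_field"
  by (rule freshmans_dream_sum') (simp_all add: CHAR_function_field)

lemma coeff_twisted_mult:
  "coeff (twisted_mult p q) n = (\<Sum>i\<le>n. coeff p i * coeff q (n - i) ^ 2 ^ i)"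
proof -
  have inner: "(\<Sum>j\<le>degree q. coeff (monom (coeff p i * coeff q j ^ 2 ^ i) (i + j)) n)
      = (if i \<le> n then coeff p i * coeff q (n - i) ^ 2 ^ i else 0)" for i
  proof (cases "i \<le> n")
    case True
    have "(\<Sum>j\<le>degree q. coeff (monom (coeff p i * coeff q j ^ 2 ^ i) (i + j)) n)
        = (\<Sum>j\<le>degree q. if j = n - i then coeff p i * coeff q j ^ 2 ^ i else 0)"
      using True by (intro sum.cong) auto
    also have "\<dots> = coeff p i * coeff q (n - i) ^ 2 ^ i"
      by (simp add: sum.delta' coeff_eq_0)
    finally show ?thesis using True by simp
  qed simp
  have "coeff (twisted_mult p q) n
      = (\<Sum>i\<le>degree p. if i \<le> n then coeff p i * coeff q (n - i) ^ 2 ^ i else 0)"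
    by (simp add: twisted_mult_def coeff_sum inner del: coeff_monom)
  also have "\<dots> = (\<Sum>i\<in>{..degree p} \<inter> {..n}. coeff p i * coeff q (n - i) ^ 2 ^ i)"
    by (simp only: sum.inter_restrict finite_atMost atMost_iff)
  also have "\<dots> = (\<Sum>i\<le>n. coeff p i * coeff q (n - i) ^ 2 ^ i)"
    by (rule sum.mono_neutral_left) (auto simp: coeff_eq_0)
  finally show ?thesis .
qed

lemma twisted_mult_assoc:
  "twisted_mult (twisted_mult p q) r = twisted_mult p (twisted_mult q r)"
proof (rule poly_eqI)
  fix n
  define g where "g = (\<lambda>i j. coeff p i * coeff q j ^ 2 ^ i * coeff r (n - (i + j)) ^ 2 ^ (i + j))"
  have "coeff (twisted_mult (twisted_mult p q) r) n = (\<Sum>k\<le>n. \<Sum>i\<le>k. g i (k - i))"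
    by (simp add: coeff_twisted_mult g_def sum_distrib_right)
  also have "\<dots> = (\<Sum>(i, j)\<in>{(i, j). i + j \<le> n}. g i j)"
    by (simp add: sum.triangle_reindex_eq)
  also have "{(i, j). i + j \<le> n} = Sigma {..n} (\<lambda>i. {..n - i})"
    by auto
  also have "(\<Sum>(i, j)\<in>Sigma {..n} (\<lambda>i. {..n - i}). g i j) = (\<Sum>i\<le>n. \<Sum>j\<le>n - i. g i j)"
    by (simp add: sum.Sigma)
  also have "\<dots> = coeff (twisted_mult p (twisted_mult q r)) n"
    by (simp add: coeff_twisted_mult g_def power_2_power_sum sum_distrib_left
        power_mult_distrib power_add mult.assoc flip: power_mult)
      (simp add: mult.commute)
  finally show "coeff (twisted_mult (twisted_mult p q) r) n
      = coeff (twisted_mult p (twisted_mult q r)) n" .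
qed

instantiation twisted :: ring_1
begin

definition "0 = Abs_twisted 0"
definition "1 = Abs_twisted 1"
definition "p + q = Abs_twisted (Rep_twisted p + Rep_twisted q)"
definition "p - q = Abs_twisted (Rep_twisted p - Rep_twisted q)"
definition "- p = Abs_twisted (- Rep_twisted p)"
definition "p * q = Abs_twisted (twisted_mult (Rep_twisted p) (Rep_twisted q))"

lemma tcoeff_simps:
  "tcoeff 0 n = 0"
  "tcoeff 1 n = (if n = 0 then 1 else 0)"
  "tcoeff (p + q) n = tcoeff p n + tcoeff q n"
  "tcoeff (p - q) n = tcoeff p n - tcoeff q n"
  "tcoeff (- p) n = - tcoeff p n"
  by (simp_all add: tcoeff_def zero_twisted_def one_twisted_def plus_twisted_def
      minus_twisted_def uminus_twisted_def Abs_twisted_inverse coeff_1)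

lemma tcoeff_mult: "tcoeff (p * q) n = (\<Sum>i\<le>n. tcoeff p i * tcoeff q (n - i) ^ 2 ^ i)"
  by (simp add: tcoeff_def times_twisted_def Abs_twisted_inverse coeff_twisted_mult)

instance
proof
  fix a b c :: twisted
  show "a * b * c = a * (b * c)"
    by (simp add: times_twisted_def Abs_twisted_inverse twisted_mult_assoc)
  show "1 * a = a"
  proof (rule twisted_eqI)
    fix n
    have "tcoeff (1 * a) n = (\<Sum>i\<in>{0}. tcoeff 1 i * tcoeff a (n - i) ^ 2 ^ i)"
      unfolding tcoeff_mult by (rule sum.mono_neutral_right) (auto simp: tcoeff_simps)
    thus "tcoeff (1 * a) n = tcoeff a n" by (simp add: tcoeff_simps)
  qed
  show "a * 1 = a"
  proof (rule twisted_eqI)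
    fix n
    have "tcoeff (a * 1) n = (\<Sum>i\<in>{n}. tcoeff a i * tcoeff 1 (n - i) ^ 2 ^ i)"
      unfolding tcoeff_mult by (rule sum.mono_neutral_right) (auto simp: tcoeff_simps)
    thus "tcoeff (a * 1) n = tcoeff a n" by (simp add: tcoeff_simps)
  qed
  show "(a + b) * c = a * c + b * c"
    by (rule twisted_eqI) (simp add: tcoeff_simps tcoeff_mult distrib_right sum.distrib)
  show "a * (b + c) = a * b + a * c"
    by (rule twisted_eqI)
      (simp add: tcoeff_simps tcoeff_mult distrib_left power_2_power_add sum.distrib)
  show "a + b + c = a + (b + c)" "a + b = b + a" "0 + a = a" "- a + a = 0" "a - b = a + - b"
    by (rule twisted_eqI; simp add: tcoeff_simps add_ac)+
  have "tcoeff 0 0 \<noteq> tcoeff 1 0" by (simp add: tcoeff_simps)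
  thus "(0 :: twisted) \<noteq> 1" by metis
qed

end

lemma two_twisted: "u + u = 0" for u :: twisted
  by (rule twisted_eqI) (simp only: tcoeff_simps two_function_field)

text \<open>The action of a twisted polynomial on power series, with \<open>\<tau> f = f^2\<close>.\<close>

definition twisted_act :: "twisted \<Rightarrow> function_field fps \<Rightarrow> function_field fps" where
  "twisted_act p f = (\<Sum>i\<le>tdegree p. fps_const (tcoeff p i) * f ^ 2 ^ i)"


section \<open>The Drinfeld module\<close>

text \<open>
  Homomorphisms of F2-algebras; compatibility with the scalars 0 and 1 is automatic.
\<close>

definition F2_algebra_hom :: "(coord_ring \<Rightarrow> 'a :: ring_1) \<Rightarrow> bool" where
  "F2_algebra_hom \<phi> \<longleftrightarrow> \<phi> 1 = 1 \<and> (\<forall>u v. \<phi> (u + v) = \<phi> u + \<phi> v) \<and> (\<forall>u v. \<phi> (u * v) = \<phi> u * \<phi> v)"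

definition rho_x :: twisted where
  "rho_x = tpoly [xK, xK ^ 2 + xK, 1]"

definition rho_y :: twisted where
  "rho_y = tpoly [yK, yK ^ 2 + yK, xK * (yK ^ 2 + yK), 1]"

definition rho :: "coord_ring \<Rightarrow> twisted" where
  "rho = (THE \<phi>. F2_algebra_hom \<phi> \<and> \<phi> xA = rho_x \<and> \<phi> yA = rho_y)"

definition bit_eval :: "'a \<Rightarrow> bit poly \<Rightarrow> 'a :: ring_1" where
  "bit_eval r p = fold_coeffs (\<lambda>c v. of_bit c + r * v) p 0"

lemma bit_eval_0 [simp]: "bit_eval r 0 = 0"
  by (simp add: bit_eval_def)

lemma bit_eval_pCons [simp]: "bit_eval r (pCons c p) = of_bit c + r * bit_eval r p"
  by (cases "p = 0"; cases "c = 0") (auto simp: bit_eval_def)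

lemma bit_eval_add:
  fixes r :: "'a :: ring_1"
  assumes two: "(1 :: 'a) + 1 = 0"
  shows "bit_eval r (p + q) = bit_eval r p + bit_eval r q"
proof (induction p q rule: poly_induct2)
  case (pCons c p d q)
  have "(of_bit (c + d) :: 'a) = of_bit c + of_bit d"
    using two by (cases c; cases d) simp_all
  thus ?case by (simp add: pCons distrib_left)
qed simp

lemma bit_eval_commute:
  fixes r s :: "'a :: ring_1"
  assumes "r * s = s * r"
  shows "bit_eval r p * s = s * bit_eval r p"
proof (induction p)
  case (pCons c p)
  have "(of_bit c :: 'a) * s = s * of_bit c" by simp
  moreover have "r * bit_eval r p * s = s * (r * bit_eval r p)"
    by (metis pCons.IH assms mult.assoc)
  ultimately show ?case by (simp add: distrib_left distrib_right)
qed simp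

lemma bit_eval_mult:
  fixes r :: "'a :: ring_1"
  assumes two: "(1 :: 'a) + 1 = 0"
  shows "bit_eval r (p * q) = bit_eval r p * bit_eval r q"
proof (induction p)
  case (pCons c p)
  have "bit_eval r (smult c q) = of_bit c * bit_eval r q"
    by (cases c) simp_all
  thus ?case
    by (simp add: pCons bit_eval_add[OF two] distrib_right mult.assoc)
qed simp

text \<open>The universal property of the coordinate ring.\<close>

lemma F2_algebra_hom_ex1:
  fixes r s :: "'a :: ring_1"
  assumes two: "(1 :: 'a) + 1 = 0"
    and comm: "r * s = s * r"
    and curve: "s * s + s + r * r * r + r + 1 = 0"
  shows "\<exists>!\<phi>. F2_algebra_hom \<phi> \<and> \<phi> xA = r \<and> \<phi> yA = s"
proof (rule ex_ex1I)
  note add = bit_eval_add[OF two] and mult = bit_eval_mult[OF two]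
  let ?f = "[:1, 1, 0, 1:] :: bit poly"
  have two': "u + u = 0" for u :: 'a
    using two by (metis distrib_left mult_1_right mult_zero_right)
  define \<phi> where "\<phi> = (\<lambda>u. THE v. \<exists>a b. u = elt a b \<and> v = bit_eval r a + bit_eval r b * s)"
  have phi: "\<phi> (elt a b) = bit_eval r a + bit_eval r b * s" for a b
    unfolding \<phi>_def by (rule the_equality) (auto simp: elt_inject)
  have f: "bit_eval r ?f = r * r * r + r + 1"
    by (simp add: algebra_simps)
  have ss: "s * s = s + bit_eval r ?f"
  proof -
    have "s * s + (s + bit_eval r ?f) = 0"
      unfolding f using curve by (simp add: add.assoc)
    thus ?thesis by (metis two' add_right_cancel)
  qed
  have "\<phi> 1 = 1"
    by (simp add: phi one_pCons flip: elt_1)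
  moreover have "\<phi> (u + v) = \<phi> u + \<phi> v" for u v
  proof -
    obtain a b c d where "u = elt a b" "v = elt c d" using elt_surj by metis
    thus ?thesis by (simp add: elt_add phi add distrib_right add_ac)
  qed
  moreover have "\<phi> (u * v) = \<phi> u * \<phi> v" for u v
  proof -
    obtain a b c d where uv: "u = elt a b" "v = elt c d" using elt_surj by metis
    define A B C D where "A = bit_eval r a" "B = bit_eval r b" "C = bit_eval r c" "D = bit_eval r d"
    note ABCD = this
    have sC: "s * C = C * s" and sD: "s * D = D * s"
      unfolding ABCD by (simp_all only: bit_eval_commute[OF comm])
    have "\<phi> (u * v) = A * C + B * D * bit_eval r ?f + (A * D + B * C + B * D) * s"
      unfolding uv elt_mult phi add mult ABCD ..
    moreover have "\<phi> u * \<phi> v = A * C + A * D * s + B * C * s + B * D * (s * s)"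
      unfolding uv phi ABCD[symmetric]
      by (simp add: distrib_left distrib_right mult.assoc sC add_ac)
        (metis sD mult.assoc)
    ultimately show ?thesis unfolding ss by (simp only: distrib_left distrib_right add_ac)
  qed
  moreover have "\<phi> xA = r" "\<phi> yA = s"
    by (simp_all add: xA_def yA_def phi one_pCons)
  ultimately show "\<exists>\<phi>. F2_algebra_hom \<phi> \<and> \<phi> xA = r \<and> \<phi> yA = s"
    unfolding F2_algebra_hom_def by blast
next
  fix \<phi> \<psi> :: "coord_ring \<Rightarrow> 'a"
  have det: "\<phi> (elt a b) = bit_eval r a + bit_eval r b * s"
    if "F2_algebra_hom \<phi> \<and> \<phi> xA = r \<and> \<phi> yA = s" for \<phi> a b
  proof -
    have add: "\<phi> (u + v) = \<phi> u + \<phi> v" and mult: "\<phi> (u * v) = \<phi> u * \<phi> v" and one: "\<phi> 1 = 1" for u v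
      using that by (auto simp: F2_algebra_hom_def)
    have zero: "\<phi> 0 = 0" using add[of 0 0] by simp
    have x: "\<phi> (elt p 0) = bit_eval r p" for p
    proof (induction p)
      case (pCons c p)
      have "elt (pCons c p) 0 = of_bit c + xA * elt p 0"
        by (cases c) (simp_all add: xA_def elt_mult elt_add elt_inject one_pCons flip: elt_0 elt_1)
      moreover have "\<phi> (of_bit c) = of_bit c" by (cases c) (simp_all add: zero one)
      ultimately show ?case using pCons that by (simp add: add mult)
    qed (simp add: elt_0 zero)
    have "elt a b = elt a 0 + elt b 0 * yA"
      by (simp add: yA_def elt_mult elt_add)
    thus ?thesis using that by (simp add: add mult x)
  qed
  assume "F2_algebra_hom \<phi> \<and> \<phi> xA = r \<and> \<phi> yA = s" "F2_algebra_hom \<psi> \<and> \<psi> xA = r \<and> \<psi> yA = s"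
  thus "\<phi> = \<psi>" by (metis det elt_surj ext)
qed


lemma twisted_mult_pCons:
  "twisted_mult (pCons c p) q =
     smult c q + twisted_mult p (pCons 0 (map_poly (\<lambda>a. a ^ 2) q))"
proof (rule poly_eqI)
  fix n
  show "coeff (twisted_mult (pCons c p) q) n =
      coeff (smult c q + twisted_mult p (pCons 0 (map_poly (\<lambda>a. a ^ 2) q))) n"
  proof (cases n)
    case 0
    thus ?thesis by (simp add: coeff_twisted_mult)
  next
    case (Suc m)
    have "coeff (twisted_mult (pCons c p) q) n
        = c * coeff q n + (\<Sum>i\<le>m. coeff p i * coeff q (m - i) ^ 2 ^ Suc i)"
      unfolding coeff_twisted_mult Suc sum.atMost_Suc_shift by simp
    also have "(\<Sum>i\<le>m. coeff p i * coeff q (m - i) ^ 2 ^ Suc i)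
        = coeff (twisted_mult p (pCons 0 (map_poly (\<lambda>a. a ^ 2) q))) n"
      unfolding coeff_twisted_mult Suc sum.atMost_Suc
      by (auto intro!: sum.cong simp: Suc_diff_le coeff_map_poly power_mult zero_power)
    finally show ?thesis by simp
  qed
qed

lemma twisted_mult_0: "twisted_mult 0 q = 0"
  by (rule poly_eqI) (simp add: coeff_twisted_mult)

context
begin

private abbreviation "K a b \<equiv> to_fract (elt a b)"

private lemma K_add: "K a b + K c d = K (a + c) (b + d)"
  by (simp flip: elt_add)

private lemma K_mult: "K a b * K c d = K (a * c + b * d * [:1, 1, 0, 1:]) (a * d + b * c + b * d)"
  by (simp only: elt_mult[symmetric] to_fract_mult)

private lemma K_0: "0 = K 0 0" and K_1: "1 = K 1 0"
  by (simp_all add: elt_0 elt_1)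

private lemma rho_x_elt: "rho_x = Abs_twisted [:K [:0, 1:] 0, K [:0, 1, 1:] 0, K 1 0:]"
  unfolding rho_x_def tpoly_def xA_def power2_eq_square K_mult K_add
  by (simp add: elt_1 elt_0)

private lemma rho_y_elt:
  "rho_y = Abs_twisted [:K 0 1, K [:1, 1, 0, 1:] 0, K [:0, 1, 1, 0, 1:] 0, K 1 0:]"
  unfolding rho_y_def tpoly_def xA_def yA_def power2_eq_square K_mult K_add
  by (simp add: elt_1 elt_0 two_bit_poly two_bit_poly')

private lemmas tw_calc = rho_x_elt rho_y_elt times_twisted_def plus_twisted_def
  one_twisted_def zero_twisted_def
  Abs_twisted_inverse Abs_twisted_inject twisted_mult_pCons twisted_mult_0 power2_eq_square
  map_poly_pCons K_mult K_add elt_inject two_bit_poly two_bit_poly' one_pCons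

lemma rho_x_rho_y: "rho_x * rho_y = rho_y * rho_x"
  by (simp add: tw_calc)

lemma rho_curve: "rho_y * rho_y + rho_y + rho_x * rho_x * rho_x + rho_x + 1 = 0"
  by (simp add: tw_calc elt_0) (metis K_1 one_pCons two_function_field)

end

lemma rho_ex1: "\<exists>!\<phi>. F2_algebra_hom \<phi> \<and> \<phi> xA = rho_x \<and> \<phi> yA = rho_y"
  by (rule F2_algebra_hom_ex1[OF two_twisted rho_x_rho_y rho_curve])

lemma rho: "F2_algebra_hom rho" "rho xA = rho_x" "rho yA = rho_y"
  using theI'[OF rho_ex1] by (simp_all add: rho_def)


section \<open>Exponential and logarithm\<close>

text \<open>\<open>e oo (fps_const xK * fps_X)\<close> is e(x z).\<close>

definition is_normalized_exp :: "function_field fps \<Rightarrow> bool" where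
  "is_normalized_exp e \<longleftrightarrow>
     (\<forall>n. (\<nexists>i. n = 2 ^ i) \<longrightarrow> e $ n = 0) \<and> e $ 1 = 1 \<and>
     e oo (fps_const xK * fps_X) = twisted_act (rho xA) e"

definition rho_exp :: "function_field fps" where
  "rho_exp = (THE e. is_normalized_exp e)"

definition rho_log :: "function_field fps" where
  "rho_log = fps_inv rho_exp"

text \<open>The reciprocals of the coefficients a_k, b_k of z^(2^k) in exponential and logarithm.\<close>

definition exp_den :: "nat \<Rightarrow> function_field" where
  "exp_den k = 1 / rho_exp $ (2 ^ k)"

definition log_den :: "nat \<Rightarrow> function_field" where
  "log_den k = 1 / rho_log $ (2 ^ k)"

lemma fps_square_nth:
  "(f ^ 2) $ n = (if even n then (f $ (n div 2)) ^ 2 else 0)" for f :: "function_field fps"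
proof -
  let ?g = "\<lambda>i. f $ i * f $ (n - i)"
  let ?L = "{i. i \<le> n \<and> 2 * i < n}" and ?U = "{i. i \<le> n \<and> n < 2 * i}" and ?M = "{i. 2 * i = n}"
  have [simp]: "finite ?L" "finite ?U" "finite ?M"
    by (rule finite_subset[of _ "{..n}"]; auto)+
  have "(f ^ 2) $ n = sum ?g {0..n}"
    by (simp add: power2_eq_square fps_mult_nth)
  also have "{0..n} = (?L \<union> ?U) \<union> ?M" by auto
  also have "sum ?g ((?L \<union> ?U) \<union> ?M) = sum ?g (?L \<union> ?U) + sum ?g ?M"
    by (rule sum.union_disjoint) auto
  also have "sum ?g (?L \<union> ?U) = sum ?g ?L + sum ?g ?U"
    by (rule sum.union_disjoint) auto
  also have "sum ?g ?U = sum ?g ?L"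
    by (rule sum.reindex_bij_witness[of _ "\<lambda>i. n - i" "\<lambda>i. n - i"]) (auto simp: mult.commute)
  also have "sum ?g ?L + sum ?g ?L = 0" by (rule two_function_field)
  also have "sum ?g ?M = (if even n then (f $ (n div 2)) ^ 2 else 0)"
  proof (cases "even n")
    case True
    hence "?M = {n div 2}" "n - n div 2 = n div 2" by auto
    thus ?thesis using True by (simp add: power2_eq_square)
  next
    case False
    hence "?M = {}" by auto
    thus ?thesis using False by simp
  qed
  finally show ?thesis by simp
qed

lemma rho_x_act:
  "twisted_act (rho xA) f = fps_const xK * f + fps_const (xK ^ 2 + xK) * f ^ 2 + f ^ 4"
proof -
  have "tdegree rho_x = 2" by (simp add: tdegree_def rho_x_def tpoly_def Abs_twisted_inverse)
  thus ?thesis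
    by (simp add: twisted_act_def rho rho_x_def numeral_2_eq_2 nth_default_Cons)
      (simp add: power4_eq_xxxx mult.assoc)
qed

lemma rho_x_act_nth:
  "twisted_act (rho xA) f $ n = xK * f $ n
     + (if even n then (xK ^ 2 + xK) * (f $ (n div 2)) ^ 2 else 0)
     + (if 4 dvd n then (f $ (n div 4)) ^ 4 else 0)"
proof -
  have "f ^ 4 = (f ^ 2) ^ 2" by (simp flip: power_mult)
  hence "(f ^ 4) $ n =
      (if even n then (if even (n div 2) then (f $ (n div 2 div 2)) ^ 2 else 0) ^ 2 else 0)"
    by (simp only: fps_square_nth)
  moreover have "4 dvd n \<longleftrightarrow> even n \<and> even (n div 2)" by presburger
  moreover have "n div 2 div 2 = n div 4" by simp
  ultimately have "(f ^ 4) $ n = (if 4 dvd n then (f $ (n div 4)) ^ 4 else 0)"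
    by (simp flip: power_mult)
  thus ?thesis by (simp add: rho_x_act fps_square_nth)
qed

lemma xA_power: "xA ^ n = elt (monom 1 n) 0"
  by (induction n)
    (simp_all add: xA_def elt_mult elt_inject monom_0 one_pCons monom_Suc flip: elt_1)

lemma to_fract_power_nat: "to_fract (u ^ n) = to_fract u ^ n"
  by (induction n) simp_all

lemma x_bracket_nonzero: "xK ^ 2 ^ Suc j + xK \<noteq> 0"
proof
  assume "xK ^ 2 ^ Suc j + xK = 0"
  hence "xK ^ 2 ^ Suc j = xK" using two_function_field by (metis add_right_cancel)
  hence "to_fract (xA ^ 2 ^ Suc j) = to_fract (xA ^ 1)"
    by (simp add: to_fract_power_nat)
  hence "monom 1 (2 ^ Suc j) = (monom 1 1 :: bit poly)"
    unfolding to_fract_eq_iff xA_power elt_inject by simp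
  hence "degree (monom 1 (2 ^ Suc j) :: bit poly) = degree (monom 1 1 :: bit poly)"
    by simp
  thus False by (simp add: degree_monom_eq)
qed

lemma normalized_exp_recursion:
  assumes "is_normalized_exp e"
  shows "e $ (2 ^ 0) = 1" "e $ (2 ^ 1) = 1"
    "e $ (2 ^ Suc (Suc j)) =
       ((xK ^ 2 + xK) * (e $ (2 ^ Suc j)) ^ 2 + (e $ (2 ^ j)) ^ 4) / (xK ^ 2 ^ Suc (Suc j) + xK)"
proof -
  have eq: "xK ^ n * e $ n = twisted_act (rho xA) e $ n" for n
    using assms by (simp add: is_normalized_exp_def fps_compose_linear flip: fps_eq_iff)
      (metis fps_nth_Abs_fps)
  have solve: "u = v / (w + xK)" if "w * u = xK * u + v" "w + xK \<noteq> 0" for u v w :: function_field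
  proof -
    have "(w + xK) * u = v + (xK * u + xK * u)"
      using that(1) by (simp add: distrib_right add_ac)
    hence "(w + xK) * u = v" by (simp add: two_function_field)
    thus ?thesis using that(2) by (simp add: field_simps)
  qed
  show e0: "e $ (2 ^ 0) = 1" using assms by (simp add: is_normalized_exp_def)
  have "xK ^ 2 * e $ 2 = xK * e $ 2 + (xK ^ 2 + xK)"
    using eq[of 2] e0 by (simp add: rho_x_act_nth)
  from solve[OF this] x_bracket_nonzero[of 0] show "e $ (2 ^ 1) = 1" by simp
  have "xK ^ 2 ^ Suc (Suc j) * e $ (2 ^ Suc (Suc j)) = xK * e $ (2 ^ Suc (Suc j)) +
      ((xK ^ 2 + xK) * (e $ (2 ^ Suc j)) ^ 2 + (e $ (2 ^ j)) ^ 4)"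
    using eq[of "2 ^ Suc (Suc j)"] by (simp add: rho_x_act_nth add_ac)
  from solve[OF this x_bracket_nonzero]
  show "e $ (2 ^ Suc (Suc j)) =
      ((xK ^ 2 + xK) * (e $ (2 ^ Suc j)) ^ 2 + (e $ (2 ^ j)) ^ 4) / (xK ^ 2 ^ Suc (Suc j) + xK)" .
qed

fun exp_coeff :: "nat \<Rightarrow> function_field" where
  "exp_coeff 0 = 1"
| "exp_coeff (Suc 0) = 1"
| "exp_coeff (Suc (Suc j)) =
     ((xK ^ 2 + xK) * exp_coeff (Suc j) ^ 2 + exp_coeff j ^ 4) / (xK ^ 2 ^ Suc (Suc j) + xK)"

lemma normalized_exp_exists: "\<exists>e. is_normalized_exp e"
proof -
  define e where "e = Abs_fps (\<lambda>n. if \<exists>i. n = 2 ^ i then exp_coeff (THE i. n = 2 ^ i) else 0)"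
  have e: "e $ (2 ^ i) = exp_coeff i" for i
    unfolding e_def by auto
  have e0: "e $ n = 0" if "\<nexists>i. n = 2 ^ i" for n
    using that by (simp add: e_def)
  have "xK ^ n * e $ n = twisted_act (rho xA) e $ n" for n
  proof (cases "\<exists>i. n = 2 ^ i")
    case False
    have "e $ (n div 2) = 0" if "even n"
    proof (rule e0, rule notI)
      assume "\<exists>i. n div 2 = 2 ^ i"
      then obtain i where "n div 2 = 2 ^ i" by blast
      with \<open>even n\<close> have "n = 2 ^ Suc i" by auto
      with False show False by blast
    qed
    moreover have "e $ (n div 4) = 0" if "4 dvd n"
    proof (rule e0, rule notI)
      assume "\<exists>i. n div 4 = 2 ^ i"
      then obtain i where "n div 4 = 2 ^ i" by blast
      with \<open>4 dvd n\<close> have "n = 2 ^ Suc (Suc i)" by auto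
      with False show False by blast
    qed
    ultimately show ?thesis using e0[OF False] by (auto simp: rho_x_act_nth)
  next
    case True
    then obtain i where n: "n = 2 ^ i" by blast
    consider "i = 0" | "i = 1" | j where "i = Suc (Suc j)"
      by (metis One_nat_def not0_implies_Suc)
    thus ?thesis
    proof cases
      case 1
      thus ?thesis by (simp add: n rho_x_act_nth)
    next
      case 2
      have "e $ 2 = 1" "e $ 1 = 1" using e[of 1] e[of 0] by simp_all
      moreover have "xK + (xK ^ 2 + xK) = xK ^ 2"
        by (metis add.commute add.assoc add_0 two_function_field)
      moreover have "twisted_act (rho xA) e $ 2 = xK * e $ 2 + (xK ^ 2 + xK) * (e $ 1) ^ 2"
        by (simp add: rho_x_act_nth)
      ultimately show ?thesis by (simp add: n 2)
    next
      case (3 j)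
      let ?w = "xK ^ 2 ^ Suc (Suc j)"
      let ?v = "(xK ^ 2 + xK) * exp_coeff (Suc j) ^ 2 + exp_coeff j ^ 4"
      have "(?w + xK) * exp_coeff i = ?v"
        unfolding 3 exp_coeff.simps(3) using x_bracket_nonzero[of "Suc j"] by simp
      hence "?w * exp_coeff i = xK * exp_coeff i + ?v"
        by (metis add.assoc add.commute add_0 distrib_right two_function_field)
      moreover have "e $ (2 ^ Suc (Suc j) div 2) = exp_coeff (Suc j)"
        "e $ (2 ^ Suc (Suc j) div 4) = exp_coeff j"
        using e[of "Suc j"] e[of j] by simp_all
      ultimately show ?thesis
        unfolding rho_x_act_nth n 3 using e[of "Suc (Suc j)"] by (simp add: add_ac)
    qed
  qed
  hence "e oo (fps_const xK * fps_X) = twisted_act (rho xA) e"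
    by (simp add: fps_compose_linear fps_eq_iff)
  moreover have "e $ 1 = 1" using e[of 0] by simp
  ultimately show ?thesis unfolding is_normalized_exp_def using e0 by blast
qed

lemma normalized_exp_ex1: "\<exists>!e. is_normalized_exp e"
proof (rule ex_ex1I[OF normalized_exp_exists])
  fix e e' assume e: "is_normalized_exp e" and e': "is_normalized_exp e'"
  have "e $ (2 ^ i) = e' $ (2 ^ i)" for i
  proof (induction i rule: exp_coeff.induct)
    case 1
    show ?case by (simp only: normalized_exp_recursion(1)[OF e] normalized_exp_recursion(1)[OF e'])
  next
    case 2
    show ?case
      using normalized_exp_recursion(2)[OF e] normalized_exp_recursion(2)[OF e'] by simp
  next
    case (3 j)
    show ?case
      unfolding normalized_exp_recursion(3)[OF e] normalized_exp_recursion(3)[OF e'] 3 ..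
  qed
  moreover have "e $ n = e' $ n" if "\<nexists>i. n = 2 ^ i" for n
    using that e e' by (simp add: is_normalized_exp_def)
  ultimately show "e = e'" unfolding fps_eq_iff by metis
qed

lemma rho_exp: "is_normalized_exp rho_exp"
  unfolding rho_exp_def by (rule theI'[OF normalized_exp_ex1])

lemma rho_exp_nth_0: "rho_exp $ 0 = 0"
  using rho_exp by (simp add: is_normalized_exp_def)

lemma rho_exp_nth_1: "rho_exp $ 1 = 1"
  using rho_exp by (simp add: is_normalized_exp_def)

lemma rho_exp_log: "rho_log oo rho_exp = fps_X" "rho_exp oo rho_log = fps_X"
  unfolding rho_log_def
  by (rule fps_inv fps_inv_right; simp add: rho_exp_nth_0 rho_exp_nth_1[simplified])+

end

theory Submission
  imports Defs
begin

text \<open>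
  Write x_m and y_m for the 2^m-th powers of x and y, so that P_m = (x_m, y_m) are the Frobenius
  conjugates of the generic point P_0 = (x, y) of the elliptic curve E. Everything rests on the
  shtuka function of the Drinfeld module: with the line of slope x through P_0,

      f_j(m) = (y_m + y_j + x_j (x_m + x_j)) / (x_m + x_j + 1)

  is the j-th Frobenius twist of that function, evaluated at P_m. It satisfies a three-term
  recurrence (\<open>shtuka_recurrence\<close>), which is the functional equation of the exponential in
  disguise; hence d_k is the product of the f_j(k) over j < k (\<open>rho_exp_nth\<close>). The single
  computation behind it is the norm formula \<open>chord_norm\<close> for the numerators. The same formula
  yields a product expansion of the logarithm coefficients (\<open>rho_log_nth_prod\<close>).

  The link with D_k is a pairing. Let e_k(w) be the product of the w + a over all a in A of
  degree below k. It is additive, e_k(w) = w^(2^(k-1)) + s w^(2^(k-2)) + ..., and the coefficient s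
  obeys the recursion s' = s^2 + D_k, so s is the sum
  1 + D_(k-1) + D_(k-2)^2 + ... of the second claim, with k - 1 in place of k.
  On the other hand the functions W_n = (x_m + x + 1) f_0(m) ... f_(n-1)(m) have their only pole at
  infinity, of order n + 2, and they vanish at P_0, ..., P_(n-1). Now e_k kills every element of
  degree below k. Pairing its coefficients with the values of W_(k-2), a monic function of degree k,
  therefore leaves D_k on one side and only the two top terms on the other (\<open>deg_prod_pairing\<close>):

      D_k = g_(k-1) + s g_(k-2)    with    g_n = d_n (x_n + x + 1).

  Comparing with the recursion for s gives s = g_(k-2) (\<open>subleading_eq_scaled_exp_den\<close>), so that
  D_k = g_(k-1) + g_(k-2)^2. From here on d_k, D_k and the logarithm coefficients are all explicit
  in the quantities of \<open>chord_norm\<close>, and the three claims reduce to polynomial identities in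
  characteristic 2, modulo that norm formula.
\<close>

section \<open>Frobenius conjugates of the generic point\<close>

lemma char2_cancel: "u + (u + v) = v" for u v :: function_field
  by (metis add.assoc add_0 two_function_field)

lemma char2_two: "(2 :: function_field) = 0"
  using two_function_field[of 1] by simp

text \<open>
  As a rewrite rule this loops, so it is only applied to a fixed left-hand term.
\<close>

lemma char2_eq_iff: "u = v \<longleftrightarrow> u + v = 0" for u v :: function_field
  by (metis add_right_cancel two_function_field)

lemmas char2 = two_function_field char2_cancel char2_two

definition x_frob :: "nat \<Rightarrow> function_field" where "x_frob m = xK ^ 2 ^ m"
definition y_frob :: "nat \<Rightarrow> function_field" where "y_frob m = yK ^ 2 ^ m"

lemma x_frob_Suc: "x_frob (Suc m) = (x_frob m)^2"
  by (simp add: x_frob_def mult.commute flip: power_mult)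
lemma y_frob_Suc: "y_frob (Suc m) = (y_frob m)^2"
  by (simp add: y_frob_def mult.commute flip: power_mult)

lemma curve_frob: "(y_frob m)^2 = y_frob m + (x_frob m)^3 + x_frob m + 1"
proof -
  have "yK^2 + yK + xK^3 + xK + 1 = 0"
    using arg_cong[OF curve_equation, of to_fract] by (simp add: to_fract_power_nat)
  hence "(yK^2 + yK + xK^3 + xK + 1) ^ 2^m = 0" by simp
  hence "(yK^2)^2^m + y_frob m + (xK^3)^2^m + x_frob m + 1 = 0"
    by (simp add: x_frob_def y_frob_def power_2_power_add)
  hence "(y_frob m)^2 + (y_frob m + (x_frob m)^3 + x_frob m + 1) = 0"
    by (simp add: x_frob_def y_frob_def mult.commute add.assoc flip: power_mult)
  thus ?thesis unfolding char2_eq_iff[of "(y_frob m)^2"] .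
qed

lemma x_frob_sum_plus_1_nonzero: "x_frob i + x_frob j + 1 \<noteq> 0"
proof
  assume "x_frob i + x_frob j + 1 = 0"
  hence "to_fract (xA ^ 2^i + xA ^ 2^j + 1) = to_fract 0"
    by (simp add: x_frob_def to_fract_power_nat)
  hence "monom 1 (2^i) + monom 1 (2^j) + (1::bit poly) = 0"
    unfolding to_fract_eq_iff xA_power by (simp add: elt_add elt_inject flip: elt_1 elt_0)
  \<comment> \<open>both exponents are positive, so the constant coefficient is 1\<close>
  hence "coeff (monom 1 (2^i) + monom 1 (2^j) + (1::bit poly)) 0 = 0" by simp
  thus False by simp
qed

lemma x_frob_sum_nonzero: "i \<noteq> j \<Longrightarrow> x_frob i + x_frob j \<noteq> 0"
proof
  assume "i \<noteq> j" "x_frob i + x_frob j = 0"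
  hence "x_frob i = x_frob j" unfolding char2_eq_iff[of "x_frob i"] by simp
  hence "to_fract (xA ^ 2^i) = to_fract (xA ^ 2^j)" by (simp add: x_frob_def to_fract_power_nat)
  hence "monom 1 (2^i) = (monom 1 (2^j) :: bit poly)"
    unfolding to_fract_eq_iff xA_power elt_inject by simp
  hence "degree (monom 1 (2^i) :: bit poly) = degree (monom 1 (2^j) :: bit poly)" by simp
  with \<open>i \<noteq> j\<close> show False by (simp add: degree_monom_eq)
qed


section \<open>The shtuka function\<close>

text \<open>
  The value at P_m of the line of slope x_j through P_j. Its other two zeros are -V_j and
  V_(j+1), where V_j has abscissa x_j + 1: this is the relation P = V - Frob(V) in the group of E,
  and it makes the line, divided by X + x_j + 1, the shtuka function.
\<close>

definition chord :: "nat \<Rightarrow> nat \<Rightarrow> function_field" where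
  "chord j m = y_frob m + y_frob j + x_frob j * (x_frob m + x_frob j)"

definition shtuka :: "nat \<Rightarrow> nat \<Rightarrow> function_field" where
  "shtuka j m = chord j m / (x_frob m + x_frob j + 1)"

text \<open>
  On a line of the form Y = s X + t, the function Y + s X + t times its conjugate under
  Y \<open>\<mapsto>\<close> Y + 1 is the cubic in X whose roots are the abscissae of the three intersections
  with E. Here these are x, x + 1 and x^2 + 1. That the factors of d_k and of the logarithm
  coefficients do not vanish, and all later identities, come from this formula.
\<close>

lemma chord_norm_field:
  fixes x y X Y :: function_field
  assumes "y^2 = y + x^3 + x + 1" "Y^2 = Y + X^3 + X + 1"
  defines "p \<equiv> Y + y + x * (X + x)"
  shows "p * (p + 1) = (X + x) * (X + x + 1) * (X + x^2 + 1)"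
proof -
  have "p * (p + 1) = Y^2 + y^2 + x^2 * (X^2 + x^2) + p"
    unfolding p_def by (simp add: algebra_simps power2_eq_square char2)
  also have "\<dots> = (X + x) * (X + x + 1) * (X + x^2 + 1)"
    unfolding assms(1,2) p_def
    by (simp add: algebra_simps power2_eq_square power3_eq_cube char2)
  finally show ?thesis .
qed

lemma chord_norm:
  "chord j m * (chord j m + 1)
    = (x_frob m + x_frob j) * (x_frob m + x_frob j + 1) * (x_frob m + x_frob (Suc j) + 1)"
  unfolding chord_def x_frob_Suc by (rule chord_norm_field[OF curve_frob curve_frob])

lemma chord_norm_nonzero: "i \<noteq> j \<Longrightarrow> chord j i * (chord j i + 1) \<noteq> 0"
  unfolding chord_norm using x_frob_sum_nonzero[of i j] x_frob_sum_plus_1_nonzero[of i] by simp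

text \<open>
  The lines attached to P_j and P_(j+1) meet, up to sign, in a common point of abscissa
  x_(j+1) + 1; hence the conjugate of one differs from the other by a multiple of
  X + x_(j+1) + 1.
\<close>

lemma chord_Suc:
  "chord (Suc j) m = chord j m + 1 + (x_frob j + x_frob (Suc j)) * (x_frob m + x_frob (Suc j) + 1)"
  unfolding chord_def x_frob_Suc y_frob_Suc curve_frob
  by (simp add: algebra_simps power2_eq_square power3_eq_cube char2)

text \<open>
  Multiplying by x on the module side corresponds to this relation between consecutive twists:
  with j = 0 it is the recursion for the exponential coefficients divided by their product
  formula. Once denominators are cleared, the right-hand side is the norm of the line divided
  by two of its three factors.
\<close>

lemma shtuka_recurrence:
  "x_frob m + x_frob j = shtuka j m * shtuka (Suc j) m + (x_frob j + x_frob (Suc j)) * shtuka j m"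
proof -
  let ?U = "x_frob m + x_frob j" and ?V = "x_frob m + x_frob (Suc j) + 1"
  have nz: "?U + 1 \<noteq> 0" "?V \<noteq> 0" by (rule x_frob_sum_plus_1_nonzero)+
  have "chord (Suc j) m = chord j m + 1 + (x_frob j + x_frob (Suc j)) * ?V"
    by (rule chord_Suc)
  hence "chord j m * (chord (Suc j) m + (x_frob j + x_frob (Suc j)) * ?V) = ?U * (?U + 1) * ?V"
    using chord_norm[of j m] by (simp add: add.assoc char2)
  hence "chord j m * (chord (Suc j) m + (x_frob j + x_frob (Suc j)) * ?V) / ((?U + 1) * ?V)
      = ?U * ((?U + 1) * ?V) / ((?U + 1) * ?V)" by (simp only: mult.assoc)
  hence "?U = chord j m * (chord (Suc j) m + (x_frob j + x_frob (Suc j)) * ?V) / ((?U + 1) * ?V)"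
    using nz by (simp only: nonzero_mult_div_cancel_right mult_eq_0_iff simp_thms)
  also have "\<dots> = shtuka j m * shtuka (Suc j) m + (x_frob j + x_frob (Suc j)) * shtuka j m"
    unfolding shtuka_def using nz by (simp add: divide_simps) (simp add: algebra_simps)
  finally show ?thesis .
qed

lemma chord_Suc_Suc: "chord (Suc j) (Suc m) = (chord j m)^2"
  unfolding chord_def x_frob_Suc y_frob_Suc
  by (simp add: algebra_simps power2_eq_square char2)

lemma shtuka_Suc_Suc: "shtuka (Suc j) (Suc m) = (shtuka j m)^2"
proof -
  have "x_frob (Suc m) + x_frob (Suc j) + 1 = (x_frob m + x_frob j + 1)^2"
    unfolding x_frob_Suc by (simp add: algebra_simps power2_eq_square char2)
  thus ?thesis by (simp add: shtuka_def chord_Suc_Suc power_divide)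
qed

lemma shtuka_self: "shtuka j j = 0"
  by (simp add: shtuka_def chord_def char2)

text \<open>
  This normalisation makes the top factor of d_k equal to 1, so that the products of the
  f_j over j < n take the values d_n at P_n and d_(n+1) at P_(n+1).
\<close>

lemma shtuka_next: "shtuka j (Suc j) = 1"
proof -
  have "chord j (Suc j) = x_frob (Suc j) + x_frob j + 1"
    unfolding chord_def x_frob_Suc y_frob_Suc curve_frob
    by (simp add: algebra_simps power2_eq_square power3_eq_cube char2)
  thus ?thesis using x_frob_sum_plus_1_nonzero[of "Suc j" j] by (simp add: shtuka_def)
qed

lemma shtuka_nonzero: "i \<noteq> j \<Longrightarrow> shtuka j i \<noteq> 0"
  using chord_norm_nonzero[of i j] x_frob_sum_plus_1_nonzero[of i j] by (auto simp: shtuka_def)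


section \<open>Coefficients of the exponential\<close>

text \<open>
  Squaring shifts both the twist and the point, so it only loses the factor with j = 0.
\<close>

lemma shtuka_prod_Suc: "(\<Prod>j<Suc k. shtuka j (Suc m)) = shtuka 0 (Suc m) * (\<Prod>j<k. shtuka j m)^2"
  unfolding prod.lessThan_Suc_shift by (simp add: shtuka_Suc_Suc prod_power_distrib)

text \<open>
  Let F_0 and F_1 be the first two factors of the product for k + 2, and P the product for k.
  The recursion for the exponential relates 1/P^4, 1/(F_1 P^4) and 1/(F_0 F_1 P^4); after
  cancelling P it is the relation between F_0 and F_1 in \<open>shtuka_recurrence\<close>.
\<close>

lemma rho_exp_nth: "rho_exp $ 2^k = 1 / (\<Prod>j<k. shtuka j k)"
proof (induction k rule: exp_coeff.induct)
  case 1
  show ?case using normalized_exp_recursion(1)[OF rho_exp] by simp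
next
  case 2
  show ?case using normalized_exp_recursion(2)[OF rho_exp] by (simp add: shtuka_next)
next
  case (3 k)
  define P where "P = (\<Prod>j<k. shtuka j k)"
  define F0 where "F0 = shtuka 0 (Suc (Suc k))"
  define F1 where "F1 = shtuka (Suc 0) (Suc (Suc k))"
  have P: "P \<noteq> 0" unfolding P_def using shtuka_nonzero[of k] by simp
  have F: "F0 \<noteq> 0" "F1 \<noteq> 0" unfolding F0_def F1_def by (simp_all add: shtuka_nonzero)
  have F1: "F1 = (shtuka 0 (Suc k))^2" unfolding F1_def by (rule shtuka_Suc_Suc)
  have P1: "(\<Prod>j<Suc k. shtuka j (Suc k))^2 = F1 * P^4"
    unfolding shtuka_prod_Suc F1 P_def by (simp add: power_mult_distrib)
  have P2: "(\<Prod>j<Suc (Suc k). shtuka j (Suc (Suc k))) = F0 * (F1 * P^4)"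
    unfolding shtuka_prod_Suc[of "Suc k"] P1 F0_def ..
  have rec: "x_frob (Suc (Suc k)) + xK = F0 * F1 + (xK^2 + xK) * F0"
    using shtuka_recurrence[of "Suc (Suc k)" 0]
    unfolding F0_def F1_def by (simp add: x_frob_def add.commute power2_eq_square)
  have nz: "x_frob (Suc (Suc k)) + xK \<noteq> 0"
    using x_frob_sum_nonzero[of "Suc (Suc k)" 0] by (simp add: x_frob_def)
  have sq: "(1 / (\<Prod>j<Suc k. shtuka j (Suc k)))^2 = 1 / (F1 * P^4)"
    by (simp only: power_divide P1 power_one)
  have fp: "(1 / P)^4 = 1 / P^4" by (simp add: power_divide)
  have "rho_exp $ 2 ^ Suc (Suc k) =
      ((xK^2 + xK) * (1 / (F1 * P^4)) + 1 / P^4) / (x_frob (Suc (Suc k)) + xK)"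
    unfolding normalized_exp_recursion(3)[OF rho_exp] 3 sq P_def[symmetric] fp x_frob_def ..
  also have "(xK^2 + xK) * (1 / (F1 * P^4)) + 1 / P^4
      = (x_frob (Suc (Suc k)) + xK) / (F0 * (F1 * P^4))"
    unfolding rec using P F by (simp add: field_simps)
  also have "\<dots> / (x_frob (Suc (Suc k)) + xK) = 1 / (F0 * (F1 * P^4))" using nz by simp
  finally show ?case unfolding P2 .
qed

lemma exp_den_shtuka: "exp_den k = (\<Prod>j<k. shtuka j k)"
  unfolding exp_den_def rho_exp_nth by simp

lemma exp_den_nonzero: "exp_den k \<noteq> 0"
  unfolding exp_den_shtuka using shtuka_nonzero[of k] by simp

lemma exp_den_Suc: "exp_den (Suc k) = shtuka 0 (Suc k) * (exp_den k)^2"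
  unfolding exp_den_shtuka by (rule shtuka_prod_Suc)


section \<open>Coefficients of the logarithm\<close>

text \<open>
  The additive power series c_0 z + c_1 z^2 + c_2 z^4 + ...
\<close>

definition additive_fps :: "(nat \<Rightarrow> function_field) \<Rightarrow> function_field fps" where
  "additive_fps c = Abs_fps (\<lambda>n. if \<exists>i. n = 2^i then c (THE i. n = 2^i) else 0)"

lemma additive_fps_nth_power: "additive_fps c $ 2^i = c i"
  by (auto simp: additive_fps_def)

lemma additive_fps_nth_other: "(\<nexists>i. n = 2^i) \<Longrightarrow> additive_fps c $ n = 0"
  by (simp add: additive_fps_def)

lemma fps_power_2_power_nth:
  "(f ^ 2^r) $ n = (if 2^r dvd n then (f $ (n div 2^r)) ^ 2^r else 0)" for f :: "function_field fps"
proof (induction r arbitrary: n)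
  case (Suc r)
  have "(f ^ 2^Suc r) $ n = ((f ^ 2^r)^2) $ n" by (simp add: mult.commute flip: power_mult)
  also have "\<dots> = (if even n then (f ^ 2^r $ (n div 2))^2 else 0)" by (rule fps_square_nth)
  also have "\<dots> = (if 2^Suc r dvd n then (f $ (n div 2^Suc r)) ^ 2^Suc r else 0)"
  proof (cases "even n")
    case True
    then obtain m where "n = 2 * m" by blast
    thus ?thesis unfolding Suc by (auto simp: mult.commute simp flip: power_mult)
  next
    case False
    hence "\<not> 2^Suc r dvd n" by (metis dvd_trans dvd_triv_left power_Suc)
    with False show ?thesis by simp
  qed
  finally show ?case .
qed simp

text \<open>
  Composition of two such series is the twisted product of their coefficient sequences,
  because raising to the power 2^i acts on each coefficient separately.
\<close>

lemma additive_fps_compose_nth: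
  assumes "\<And>n. (\<nexists>i. n = 2^i) \<Longrightarrow> f $ n = 0"
  shows "(additive_fps c oo f) $ n =
    (if \<exists>k. n = 2^k then \<Sum>i\<le>(THE k. n = 2^k). c i * (f $ 2^((THE k. n = 2^k) - i)) ^ 2^i else 0)"
proof -
  have other: "(f ^ 2^r) $ n = 0" if "\<not> (\<exists>k\<ge>r. n = 2^k)" for r
  proof (cases "2^r dvd n")
    case True
    then obtain m where m: "n = 2^r * m" by blast
    have "\<nexists>i. m = 2^i"
    proof
      assume "\<exists>i. m = 2^i"
      then obtain i where "m = 2^i" by blast
      hence "n = 2^(r+i)" using m by (simp add: power_add)
      with that show False by (metis le_add1)
    qed
    thus ?thesis using assms[of m] m by (simp add: fps_power_2_power_nth)
  qed (simp add: fps_power_2_power_nth)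
  have sum: "(additive_fps c oo f) $ n = (\<Sum>i\<in>{0..n}. additive_fps c $ i * (f ^ i) $ n)"
    by (simp add: fps_compose_nth)
  show ?thesis
  proof (cases "\<exists>k. n = 2^k")
    case False
    have "additive_fps c $ i * (f ^ i) $ n = 0" for i
    proof (cases "\<exists>r. i = 2^r")
      case True
      then obtain r where "i = 2^r" by blast
      thus ?thesis using other[of r] False by auto
    qed (simp add: additive_fps_nth_other)
    hence "(additive_fps c oo f) $ n = 0" unfolding sum by (intro sum.neutral ballI)
    thus ?thesis using False by (simp only: if_False)
  next
    case True
    then obtain k where k: "n = 2^k" by blast
    have "(additive_fps c oo f) $ n = (\<Sum>i\<in>(\<lambda>r. 2^r) ` {..k}. additive_fps c $ i * (f ^ i) $ n)"
      unfolding sum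
    proof (rule sum.mono_neutral_right)
      show "(\<lambda>r. 2^r) ` {..k} \<subseteq> {0..n}" unfolding k by auto
      show "\<forall>i\<in>{0..n} - (\<lambda>r. 2^r) ` {..k}. additive_fps c $ i * (f ^ i) $ n = 0"
      proof
        fix i assume i: "i \<in> {0..n} - (\<lambda>r. 2^r) ` {..k}"
        show "additive_fps c $ i * (f ^ i) $ n = 0"
        proof (cases "\<exists>r. i = 2^r")
          case True
          then obtain r where r: "i = 2^r" by blast
          have "r \<le> k" using i unfolding k r by simp
          with i r show ?thesis by auto
        qed (simp add: additive_fps_nth_other)
      qed
    qed simp
    also have "\<dots> = (\<Sum>r\<le>k. additive_fps c $ 2^r * (f ^ 2^r) $ n)"
      by (subst sum.reindex) (auto simp: inj_on_def)
    also have "\<dots> = (\<Sum>r\<le>k. c r * (f $ 2^(k-r)) ^ 2^r)"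
      by (rule sum.cong)
        (auto simp: additive_fps_nth_power fps_power_2_power_nth k le_imp_power_dvd
          simp flip: power_diff)
    finally show ?thesis using k by auto
  qed
qed

lemma rho_log_unique:
  assumes "L oo rho_exp = fps_X"
  shows "rho_log = L"
proof -
  have log0: "rho_log $ 0 = 0" by (simp add: rho_log_def fps_inv_def)
  have "L = L oo (rho_exp oo rho_log)" by (simp add: rho_exp_log)
  also have "\<dots> = (L oo rho_exp) oo rho_log"
    by (rule fps_compose_assoc) (simp_all add: log0 rho_exp_nth_0)
  also have "\<dots> = rho_log" by (simp add: assms log0)
  finally show ?thesis ..
qed

text \<open>
  The recursion for b says that L = \<open>additive_fps b\<close> satisfies L(rho_x(z)) = x L(z). Then
  M = L(e(z)) satisfies M(x z) = x M(z), so the coefficients of M beyond the first vanish, as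
  x_k \<open>\<noteq>\<close> x for k > 0; thus M(z) = z. The proof carries out this comparison of coefficients.
\<close>

lemma rho_log_nth:
  assumes b0: "b 0 = 1" "b (Suc 0) = 1"
    and rec: "\<And>j. (x_frob (Suc (Suc j)) + x_frob 0) * b (Suc (Suc j))
        = (x_frob (Suc j) + x_frob (Suc (Suc j))) * b (Suc j) + b j"
  shows "rho_log $ 2^k = b k"
proof -
  define a where "a = (\<lambda>k. rho_exp $ 2^k)"
  have a0: "a 0 = 1" "a (Suc 0) = 1"
    using normalized_exp_recursion(1,2)[OF rho_exp] unfolding a_def by simp_all
  have a_rec: "(x_frob (Suc (Suc j)) + x_frob 0) * a (Suc (Suc j))
      = (x_frob 0 + x_frob 1) * a (Suc j)^2 + a j^4" for j
    using normalized_exp_recursion(3)[OF rho_exp, of j] x_frob_sum_nonzero[of "Suc (Suc j)" 0]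
    unfolding a_def by (simp add: x_frob_def add.commute power2_eq_square)
  \<comment> \<open>the recursion for the exponential, raised to the power 2^i\<close>
  have a_rec': "(x_frob (Suc (Suc j) + i) + x_frob i) * a (Suc (Suc j)) ^ 2^i
      = (x_frob i + x_frob (Suc i)) * a (Suc j) ^ 2^Suc i + a j ^ 2^Suc (Suc i)" for i j
  proof -
    have X: "x_frob j ^ 2^i = x_frob (j + i)" for j
      by (simp add: x_frob_def power_add flip: power_mult)
    have "((x_frob (Suc (Suc j)) + x_frob 0) * a (Suc (Suc j))) ^ 2^i
      = ((x_frob 0 + x_frob 1) * a (Suc j)^2 + a j^4) ^ 2^i" unfolding a_rec ..
    thus ?thesis
      by (simp add: power_mult_distrib power_2_power_add X flip: power_mult)
  qed
  define M where "M = (\<lambda>k. \<Sum>i\<le>k. b i * a (k - i) ^ 2^i)"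
  have "M (Suc 0) = 0" by (simp add: M_def b0 a0 char2)
  moreover have "M (Suc (Suc k)) = 0" for k
  proof -
    let ?n = "Suc (Suc k)"
    define A where "A = (\<lambda>i. b i * a (Suc k - i) ^ 2^Suc i * (x_frob i + x_frob (Suc i)))"
    define B where "B = (\<lambda>i. b i * a (k - i) ^ 2^Suc (Suc i))"
    \<comment> \<open>the functional equation of the exponential absorbs x_n + x_i\<close>
    have left: "(\<Sum>i\<le>?n. b i * ((x_frob ?n + x_frob i) * a (?n - i) ^ 2^i))
        = (\<Sum>i\<le>Suc k. A i) + (\<Sum>i\<le>k. B i)"
    proof -
      have "b i * ((x_frob ?n + x_frob i) * a (?n - i) ^ 2^i) = A i + B i" if i: "i \<le> k" for i
      proof -
        obtain j where j: "k = j + i" using le_Suc_ex[OF i] by (auto simp: add.commute)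
        show ?thesis using a_rec'[of j i] unfolding j A_def B_def
          by (simp add: Suc_diff_le algebra_simps)
      qed
      hence "(\<Sum>i\<le>k. b i * ((x_frob ?n + x_frob i) * a (?n - i) ^ 2^i)) = (\<Sum>i\<le>k. A i + B i)"
        by (intro sum.cong) auto
      moreover have "b (Suc k) * ((x_frob ?n + x_frob (Suc k)) * a (?n - Suc k) ^ 2^Suc k)
          = A (Suc k)"
        unfolding A_def by (simp add: a0 algebra_simps)
      ultimately show ?thesis by (simp add: sum.distrib char2 add_ac)
    qed
    \<comment> \<open>that of the logarithm absorbs x_i + x_0 and yields the same sum\<close>
    have right: "(\<Sum>i\<le>?n. (x_frob i + x_frob 0) * b i * a (?n - i) ^ 2^i)
        = (\<Sum>i\<le>Suc k. A i) + (\<Sum>i\<le>k. B i)"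
    proof -
      have "(\<Sum>i\<le>?n. (x_frob i + x_frob 0) * b i * a (?n - i) ^ 2^i)
          = (\<Sum>i\<le>Suc k. (x_frob (Suc i) + x_frob 0) * b (Suc i) * a (Suc k - i) ^ 2^Suc i)"
        unfolding sum.atMost_Suc_shift[of _ "Suc k"] by (simp add: char2)
      also have "\<dots> = A 0
          + (\<Sum>i\<le>k. (x_frob (Suc (Suc i)) + x_frob 0) * b (Suc (Suc i)) * a (k - i) ^ 2^Suc (Suc i))"
        unfolding sum.atMost_Suc_shift[of _ "k"] by (simp add: A_def b0 algebra_simps)
      also have "\<dots> = A 0 + (\<Sum>i\<le>k. A (Suc i) + B i)"
        unfolding rec A_def B_def by (simp add: algebra_simps)
      finally show ?thesis unfolding sum.atMost_Suc_shift[of A k] by (simp add: sum.distrib add_ac)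
    qed
    have "(x_frob ?n + x_frob 0) * M ?n
        = (\<Sum>i\<le>?n. b i * ((x_frob ?n + x_frob i) * a (?n - i) ^ 2^i)
            + (x_frob i + x_frob 0) * b i * a (?n - i) ^ 2^i)"
      unfolding M_def sum_distrib_left
      by (rule sum.cong) (simp_all add: algebra_simps char2)
    also have "\<dots> = 0" unfolding sum.distrib left right by (rule two_function_field)
    finally show ?thesis using x_frob_sum_nonzero[of ?n 0] by simp
  qed
  ultimately have M: "M k = (if k = 0 then 1 else 0)" for k
    by (cases k rule: exp_coeff.cases) (simp_all add: M_def b0 a0)
  have "additive_fps b oo rho_exp = fps_X"
  proof (rule fps_ext)
    fix n
    have "(additive_fps b oo rho_exp) $ n = (if \<exists>k. n = 2^k then M (THE k. n = 2^k) else 0)"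
      unfolding M_def a_def
      by (rule additive_fps_compose_nth) (use rho_exp in \<open>simp add: is_normalized_exp_def\<close>)
    also have "\<dots> = fps_X $ n"
    proof (cases "\<exists>k. n = 2^k")
      case True
      then obtain k where "n = 2^k" by blast
      thus ?thesis by (auto simp: M)
    next
      case False
      hence "n \<noteq> 1" by (metis power_0)
      with False show ?thesis by simp
    qed
    finally show "(additive_fps b oo rho_exp) $ n = fps_X $ n" .
  qed
  hence "rho_log = additive_fps b" by (rule rho_log_unique)
  thus ?thesis using additive_fps_nth_power[of b k] by simp
qed

lemma chord_swap: "chord j i = chord i j + (x_frob i + x_frob j)^2"
  unfolding chord_def by (simp add: algebra_simps power2_eq_square char2)

text \<open>
  The quotient of two consecutive coefficients of the logarithm. The exchanged order of the
  arguments of \<open>chord\<close> is intended: exponential coefficients evaluate the twists f_j at P_k,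
  logarithm coefficients evaluate f_i at the generic point P_0, up to a correction that
  telescopes.
\<close>

definition log_ratio :: "nat \<Rightarrow> function_field" where
  "log_ratio i = (chord i 0 + 1) / ((x_frob i + x_frob 0) * (x_frob i + x_frob 0 + 1))"

text \<open>
  The norm formula for the line at P_i, evaluated at P_0, trades the conjugate factor in the
  numerator for the line itself.
\<close>

lemma log_ratio_times_chord:
  assumes "i \<noteq> 0"
  shows "log_ratio i * chord i 0 = x_frob (Suc i) + x_frob 0 + 1"
proof -
  have "log_ratio i * chord i 0
      = chord i 0 * (chord i 0 + 1) / ((x_frob i + x_frob 0) * (x_frob i + x_frob 0 + 1))"
    by (simp add: log_ratio_def mult.commute)
  thus ?thesis unfolding chord_norm
    using x_frob_sum_nonzero[OF assms] x_frob_sum_plus_1_nonzero[of i 0] by (simp add: add.commute)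
qed

lemma log_ratio_1: "log_ratio (Suc 0) = 1"
proof -
  have "chord 1 0 + 1 = (x_frob 1 + x_frob 0) * (x_frob 1 + x_frob 0 + 1)"
    using x_frob_Suc[of 0] y_frob_Suc[of 0] curve_frob[of 0] unfolding chord_def
    by (simp add: algebra_simps power2_eq_square power3_eq_cube char2)
  thus ?thesis
    using x_frob_sum_nonzero[of 1 0] x_frob_sum_plus_1_nonzero[of 1 0] by (simp add: log_ratio_def)
qed

text \<open>
  The three-term recursion, divided by the product of the first j ratios, involves only two
  consecutive ratios, and it follows from \<open>chord_Suc\<close> together with the norm formula.
\<close>

lemma rho_log_nth_prod: "rho_log $ 2^k = (\<Prod>i=1..k. log_ratio i)"
proof (rule rho_log_nth)
  show "(\<Prod>i=1..Suc 0. log_ratio i) = 1" by (simp add: log_ratio_1)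
next
  fix j
  let ?u = "x_frob (Suc j) + x_frob 0" and ?v = "x_frob (Suc (Suc j)) + x_frob 0"
  have nz: "chord (Suc j) 0 \<noteq> 0" "?v \<noteq> 0" "?v + 1 \<noteq> 0"
    using chord_norm_nonzero[of 0 "Suc j"] x_frob_sum_nonzero[of "Suc (Suc j)" 0]
      x_frob_sum_plus_1_nonzero by auto
  have "chord (Suc (Suc j)) 0 + 1 = (?u + ?v) * (?v + 1) + chord (Suc j) 0"
    unfolding chord_Suc[of "Suc j"] by (simp add: algebra_simps char2)
  hence "?v * log_ratio (Suc (Suc j)) = ((?u + ?v) * (?v + 1) + chord (Suc j) 0) / (?v + 1)"
    unfolding log_ratio_def using nz by simp
  also have "\<dots> = (?u + ?v) + chord (Suc j) 0 / (?v + 1)"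
    unfolding add_divide_distrib using nz by simp
  also have "?u + ?v = x_frob (Suc j) + x_frob (Suc (Suc j))"
    by (simp add: add_ac char2)
  finally have v: "?v * log_ratio (Suc (Suc j))
      = x_frob (Suc j) + x_frob (Suc (Suc j)) + chord (Suc j) 0 / (?v + 1)" .
  have "chord (Suc j) 0 / (?v + 1) * log_ratio (Suc j) = 1"
    using log_ratio_times_chord[of "Suc j"] nz by (simp add: mult.commute)
  hence step: "?v * log_ratio (Suc (Suc j)) * log_ratio (Suc j)
      = (x_frob (Suc j) + x_frob (Suc (Suc j))) * log_ratio (Suc j) + 1"
    unfolding v by (simp only: distrib_right)
  have "?v * (\<Prod>i=1..Suc (Suc j). log_ratio i)
      = ?v * log_ratio (Suc (Suc j)) * log_ratio (Suc j) * (\<Prod>i=1..j. log_ratio i)"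
    by (simp add: mult_ac)
  also have "\<dots> = ((x_frob (Suc j) + x_frob (Suc (Suc j))) * log_ratio (Suc j) + 1)
      * (\<Prod>i=1..j. log_ratio i)"
    unfolding step ..
  finally show "?v * (\<Prod>i=1..Suc (Suc j). log_ratio i)
        = (x_frob (Suc j) + x_frob (Suc (Suc j))) * (\<Prod>i=1..Suc j. log_ratio i)
          + (\<Prod>i=1..j. log_ratio i)"
    by (simp add: algebra_simps)
qed simp

lemma log_ratio_nonzero: "i \<noteq> 0 \<Longrightarrow> log_ratio i \<noteq> 0"
  using chord_norm_nonzero[of 0 i] x_frob_sum_nonzero[of i 0] x_frob_sum_plus_1_nonzero[of i 0]
  by (auto simp: log_ratio_def)


section \<open>Elements of bounded degree\<close>

lemma basis_degrees_elt:
  "basis_degrees (elt a b) = {2 * i |i. coeff a i \<noteq> 0} \<union> {2 * i + 3 |i. coeff b i \<noteq> 0}"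
  by (auto simp: basis_degrees_def elt_inject)

lemma mem_basis_degrees_elt:
  "n \<in> basis_degrees (elt a b) \<longleftrightarrow>
    (if even n then coeff a (n div 2) \<noteq> 0 else 3 \<le> n \<and> coeff b ((n - 3) div 2) \<noteq> 0)"
proof -
  have "(\<exists>i. n = 2 * i \<and> coeff a i \<noteq> 0) \<longleftrightarrow> even n \<and> coeff a (n div 2) \<noteq> 0"
    by auto
  moreover have "(\<exists>i. n = 2 * i + 3 \<and> coeff b i \<noteq> 0)
      \<longleftrightarrow> odd n \<and> 3 \<le> n \<and> coeff b ((n - 3) div 2) \<noteq> 0" (is "?L \<longleftrightarrow> ?R")
  proof
    assume ?R
    hence "n = 2 * ((n - 3) div 2) + 3" by (auto elim!: oddE)
    with \<open>?R\<close> show ?L by blast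
  qed auto
  ultimately show ?thesis unfolding basis_degrees_elt by auto
qed

lemma basis_degrees_add:
  "n \<in> basis_degrees (u + v) \<longleftrightarrow> (n \<in> basis_degrees u) \<noteq> (n \<in> basis_degrees v)"
proof -
  have bit: "a + b \<noteq> 0 \<longleftrightarrow> (a \<noteq> 0) \<noteq> (b \<noteq> 0)" for a b :: bit
    by (cases a; cases b) simp_all
  obtain a b c d where "u = elt a b" "v = elt c d" using elt_surj by metis
  thus ?thesis
    by (simp only: elt_add mem_basis_degrees_elt coeff_add bit split: if_splits) auto
qed

lemma basis_degrees_eq_empty: "basis_degrees u = {} \<longleftrightarrow> u = 0"
proof
  assume "u = 0" thus "basis_degrees u = {}"
    by (auto simp: basis_degrees_elt simp flip: elt_0)
qed (use basis_degrees_nonempty in blast)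

text \<open>
  The monomial of degree n. There is none of degree 1, where the formula gives the junk
  value y.
\<close>

definition basis_elt :: "nat \<Rightarrow> coord_ring" where
  "basis_elt n = (if even n then xA ^ (n div 2) else yA * xA ^ ((n - 3) div 2))"

lemma basis_degrees_basis_elt:
  assumes "n \<noteq> 1"
  shows "basis_degrees (basis_elt n) = {n}"
proof (cases "even n")
  case True
  thus ?thesis by (auto simp: basis_elt_def xA_power basis_degrees_elt)
next
  case False
  hence "n \<ge> 3" using assms by presburger
  have "basis_elt n = elt 0 (monom 1 ((n - 3) div 2))"
    using False by (simp add: basis_elt_def xA_power yA_def elt_mult)
  moreover have "n = 2 * ((n - 3) div 2) + 3" using False \<open>n \<ge> 3\<close> by (auto elim!: oddE)
  ultimately show ?thesis by (simp add: basis_degrees_elt)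
qed

definition below :: "nat \<Rightarrow> coord_ring set" where
  "below k = {u. basis_degrees u \<subseteq> {..<k}}"

lemma below_mono: "k \<le> l \<Longrightarrow> below k \<subseteq> below l"
  by (auto simp: below_def)

lemma basis_elt_below: "n < k \<Longrightarrow> n \<noteq> 1 \<Longrightarrow> basis_elt n \<in> below k"
  by (simp add: below_def basis_degrees_basis_elt)

lemma xA_times_below:
  assumes "u \<in> below k" shows "xA * u \<in> below (k + 2)"
proof -
  obtain a b where u: "u = elt a b" using elt_surj by blast
  have "xA * u = elt (pCons 0 a) (pCons 0 b)"
    by (simp add: u xA_def elt_mult)
  hence xu: "basis_degrees (xA * u)
      = {2 * i |i. coeff (pCons 0 a) i \<noteq> 0} \<union> {2 * i + 3 |i. coeff (pCons 0 b) i \<noteq> 0}"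
    by (simp only: basis_degrees_elt)
  have "n < k + 2" if "n \<in> basis_degrees (xA * u)" for n
  proof -
    from that consider i where "n = 2 * i" "coeff (pCons 0 a) i \<noteq> 0"
      | i where "n = 2 * i + 3" "coeff (pCons 0 b) i \<noteq> 0" unfolding xu by blast
    hence "\<exists>m\<in>basis_degrees u. n = m + 2"
    proof cases
      case (1 i)
      then obtain j where "i = Suc j" "coeff a j \<noteq> 0" by (cases i) auto
      hence "2 * j \<in> basis_degrees u" "n = 2 * j + 2"
        unfolding u basis_degrees_elt using 1 by auto
      thus ?thesis by blast
    next
      case (2 i)
      then obtain j where "i = Suc j" "coeff b j \<noteq> 0" by (cases i) auto
      hence "2 * j + 3 \<in> basis_degrees u" "n = 2 * j + 3 + 2"
        unfolding u basis_degrees_elt using 2 by auto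
      thus ?thesis by blast
    qed
    thus ?thesis using assms by (auto simp: below_def)
  qed
  thus ?thesis by (auto simp: below_def)
qed

text \<open>
  There is one monomial in each degree k other than 1, and the constants are the field with
  two elements; so an element of degree k is that monomial plus an element of smaller degree.
\<close>

lemma below_Suc:
  assumes "k \<noteq> 1"
  shows "below (Suc k) = below k \<union> (+) (basis_elt k) ` below k"
    and "below k \<inter> (+) (basis_elt k) ` below k = {}"
    and "{u. degA u = ereal (real k)} = (+) (basis_elt k) ` below k"
proof -
  let ?t = "basis_elt k"
  note bt = basis_degrees_basis_elt[OF assms]
  have shift: "u \<in> (+) ?t ` below k" if "u \<in> below (Suc k)" "k \<in> basis_degrees u" for u
  proof (rule image_eqI)
    show "u = ?t + (?t + u)" unfolding add.assoc[symmetric] two_coord_ring by simp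
    show "?t + u \<in> below k"
      using that by (auto simp: below_def basis_degrees_add bt less_Suc_eq)
  qed
  have top: "k \<in> basis_degrees u" "u \<in> below (Suc k)" if u: "u \<in> (+) ?t ` below k" for u
  proof -
    obtain v where v: "u = ?t + v" "basis_degrees v \<subseteq> {..<k}" using u by (auto simp: below_def)
    have "k \<notin> basis_degrees v" using v(2) by auto
    thus "k \<in> basis_degrees u" unfolding v(1) basis_degrees_add bt by simp
    show "u \<in> below (Suc k)"
      using v(2) unfolding v(1) below_def by (auto simp: basis_degrees_add bt less_Suc_eq)
  qed
  have low: "u \<in> below k" if u: "u \<in> below (Suc k)" "k \<notin> basis_degrees u" for u
    unfolding below_def
  proof (intro CollectI subsetI)
    fix n assume "n \<in> basis_degrees u"
    moreover from this have "n \<noteq> k" "n < Suc k" using u by (auto simp: below_def)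
    ultimately show "n \<in> {..<k}" by simp
  qed
  show "below (Suc k) = below k \<union> (+) ?t ` below k"
  proof (intro equalityI subsetI)
    fix u assume "u \<in> below (Suc k)"
    thus "u \<in> below k \<union> (+) ?t ` below k"
      using shift[of u] low[of u] by (cases "k \<in> basis_degrees u") simp_all
  next
    fix u assume "u \<in> below k \<union> (+) ?t ` below k"
    thus "u \<in> below (Suc k)" using top(2)[of u] below_mono[of k "Suc k"] by auto
  qed
  show "below k \<inter> (+) ?t ` below k = {}"
  proof (rule equals0I)
    fix u assume "u \<in> below k \<inter> (+) ?t ` below k"
    hence "u \<in> below k" "k \<in> basis_degrees u" using top(1)[of u] by simp_all
    thus False by (auto simp: below_def)
  qed
  have "degA u = ereal (real k) \<longleftrightarrow> u \<in> below (Suc k) \<and> k \<in> basis_degrees u" for u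
  proof (cases "u = 0")
    case True
    thus ?thesis using basis_degrees_eq_empty[of u] by (simp add: degA_0)
  next
    case False
    have "Max (basis_degrees u) = k \<longleftrightarrow> k \<in> basis_degrees u \<and> (\<forall>n\<in>basis_degrees u. n \<le> k)"
      using Max_eq_iff[OF finite_basis_degrees basis_degrees_nonempty[OF False]] .
    thus ?thesis unfolding degA_eq_Max[OF False] by (auto simp: below_def less_Suc_eq_le)
  qed
  hence "degA u = ereal (real k) \<longleftrightarrow> u \<in> (+) ?t ` below k" for u
    using shift[of u] top[of u] by metis
  thus "{u. degA u = ereal (real k)} = (+) ?t ` below k" by simp
qed

lemma below_2: "below 2 = {0, 1}"
proof -
  have b1: "basis_degrees 1 = {0}"
    using basis_degrees_basis_elt[of 0] by (simp add: basis_elt_def)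
  have not1: "1 \<notin> basis_degrees u" for u
  proof -
    obtain a b where "u = elt a b" using elt_surj by blast
    thus ?thesis by (simp add: mem_basis_degrees_elt)
  qed
  have below_1: "u \<in> below 1 \<longleftrightarrow> u = 0 \<or> u = 1" for u
  proof
    assume u: "u \<in> below 1"
    show "u = 0 \<or> u = 1"
    proof (cases "0 \<in> basis_degrees u")
      case True
      hence "basis_degrees (1 + u) = {}"
        using u by (auto simp: below_def basis_degrees_add b1)
      hence "1 + u = 0" by (simp add: basis_degrees_eq_empty)
      thus ?thesis by (metis add_left_cancel two_coord_ring)
    next
      case False
      hence "basis_degrees u = {}" using u by (force simp: below_def)
      thus ?thesis by (simp add: basis_degrees_eq_empty)
    qed
  qed (auto simp: below_def b1 basis_degrees_eq_empty[THEN iffD2])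
  have "n < 2 \<longleftrightarrow> n < 1" if "n \<in> basis_degrees u" for n u
    using that not1[of u] by (cases "n = 1") auto
  hence "below 2 = below 1" unfolding below_def by blast
  thus ?thesis using below_1 by auto
qed

lemma finite_below: "k \<ge> 2 \<Longrightarrow> finite (below k)"
  by (induction k rule: nat_induct_at_least) (simp_all add: below_2 below_Suc)


section \<open>The polynomial vanishing on the elements of bounded degree\<close>

definition vanishing :: "nat \<Rightarrow> function_field \<Rightarrow> function_field" where
  "vanishing k w = (\<Prod>u\<in>below k. w + to_fract u)"

lemma to_fract_prod: "to_fract (prod f A) = (\<Prod>x\<in>A. to_fract (f x))"
  for f :: "'a \<Rightarrow> coord_ring"
  by (induction A rule: infinite_finite_induct) simp_all

lemma deg_prod_vanishing:
  "k \<ge> 2 \<Longrightarrow> deg_prod k = vanishing k (to_fract (basis_elt k))"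
  unfolding deg_prod_def vanishing_def
  by (simp add: below_Suc(3) prod.reindex to_fract_prod)

text \<open>
  The set \<open>below (Suc k)\<close> is the disjoint union of \<open>below k\<close> and its translate by the new
  monomial.
\<close>

lemma vanishing_Suc:
  assumes "k \<ge> 2"
  shows "vanishing (Suc k) w = vanishing k w * vanishing k (w + to_fract (basis_elt k))"
  using assms below_Suc[of k] finite_below[of k]
  by (simp add: vanishing_def prod.union_disjoint prod.reindex add.assoc)

lemma vanishing_below: "k \<ge> 2 \<Longrightarrow> u \<in> below k \<Longrightarrow> vanishing k (to_fract u) = 0"
  unfolding vanishing_def
  by (rule prod_zero) (auto intro!: bexI[of _ u] simp: finite_below two_function_field)

lemma deg_prod_nonzero: "deg_prod k \<noteq> 0"
proof -
  have "(\<Prod>u\<in>{u. degA u = ereal (real k)}. u) \<noteq> 0"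
    using finite_degA_eq[of k] degA_0 by auto
  thus ?thesis unfolding deg_prod_def by simp
qed

text \<open>
  The sum of the second claim; up to an index shift it is also the second coefficient
  of \<open>vanishing\<close>.
\<close>

definition subleading :: "nat \<Rightarrow> function_field" where
  "subleading k = 1 + (\<Sum>i=2..k. deg_prod i ^ 2 ^ (k - i))"

lemma subleading_Suc:
  assumes "k \<ge> 1" shows "subleading (Suc k) = (subleading k)^2 + deg_prod (Suc k)"
proof -
  have "(subleading k)^2 = (subleading k)^2^1" by simp
  also have "\<dots> = 1 + (\<Sum>i=2..k. deg_prod i ^ 2 ^ (Suc k - i))"
    unfolding subleading_def power_2_power_add power_2_power_sum
    by (auto intro!: sum.cong simp: Suc_diff_le mult.commute simp flip: power_mult)
  finally show ?thesis using assms by (simp add: subleading_def)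
qed

text \<open>
  Since \<open>vanishing k\<close> is additive, \<open>vanishing_Suc\<close> becomes
  e_(k+1)(w) = e_k(w)^2 + D_k e_k(w). The leading coefficient stays 1, and the next coefficient
  follows the recursion of \<open>subleading\<close>; the lower ones are irrelevant, since they will be paired
  with zeros.
\<close>

lemma vanishing_expansion:
  "\<exists>c. \<forall>w. vanishing (n + 2) w
     = w ^ 2^(Suc n) + subleading (Suc n) * w ^ 2^n + (\<Sum>j<n. c j * w ^ 2^j)"
proof (induction n)
  case 0
  have "vanishing 2 w = w^2 + w" for w
    by (simp add: vanishing_def below_2 distrib_left power2_eq_square)
  thus ?case by (simp add: subleading_def numeral_2_eq_2)
next
  case (Suc n)
  then obtain c where c: "vanishing (n + 2) w
     = w ^ 2^(Suc n) + subleading (Suc n) * w ^ 2^n + (\<Sum>j<n. c j * w ^ 2^j)" for w by blast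
  let ?D = "deg_prod (n + 2)" and ?b = "subleading (Suc n)"
  define c' where "c' = (\<lambda>j. (if j = 0 then 0 else (c (j - 1))^2) + ?D * (if j = n then ?b else c j))"
  have add: "vanishing (n + 2) (v + w) = vanishing (n + 2) v + vanishing (n + 2) w" for v w
    unfolding c power_2_power_add distrib_left sum.distrib by (simp only: add_ac)
  have sq: "(v ^ 2^j)^2 = v ^ 2^Suc j" for v :: function_field and j
    by (simp add: mult.commute flip: power_mult)
  have sum_sq: "(\<Sum>j<n. c j * w ^ 2^j)^2 = (\<Sum>j<n. (c j)^2 * w ^ 2^Suc j)" for w
    using power_2_power_sum[of "\<lambda>j. c j * w ^ 2^j" "{..<n}" 1]
    by (simp add: power_mult_distrib sq del: power_Suc)
  have add_sq: "(v + w)^2 = v^2 + w^2" for v w :: function_field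
    using power_2_power_add[of v w 1] by simp
  have "vanishing (Suc n + 2) w = w ^ 2^(Suc (Suc n)) + subleading (Suc (Suc n)) * w ^ 2^Suc n
      + (\<Sum>j<Suc n. c' j * w ^ 2^j)" for w
  proof -
    have "vanishing (Suc n + 2) w = (vanishing (n + 2) w)^2 + ?D * vanishing (n + 2) w"
      using vanishing_Suc[of "n + 2" w] deg_prod_vanishing[of "n + 2"] add[of w]
      by (simp only: power2_eq_square distrib_left mult.commute add_Suc)
    also have "(vanishing (n + 2) w)^2
        = w ^ 2^(Suc (Suc n)) + ?b^2 * w ^ 2^Suc n + (\<Sum>j<n. (c j)^2 * w ^ 2^Suc j)"
      unfolding c add_sq sum_sq sq power_mult_distrib ..
    also have "(\<Sum>j<n. (c j)^2 * w ^ 2^Suc j)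
        = (\<Sum>j<Suc n. (if j = 0 then 0 else (c (j - 1))^2) * w ^ 2^j)"
      unfolding sum.lessThan_Suc_shift by simp
    also have "?D * vanishing (n + 2) w
        = ?D * w ^ 2^Suc n + (\<Sum>j<Suc n. ?D * (if j = n then ?b else c j) * w ^ 2^j)"
      unfolding c by (simp add: distrib_left sum_distrib_left mult.assoc add_ac)
    finally show ?thesis unfolding c'_def subleading_Suc[of "Suc n", simplified]
      by (simp add: distrib_right distrib_left sum.distrib add_ac del: sum.lessThan_Suc power_Suc)
  qed
  thus ?case by blast
qed


section \<open>Pairing with functions on the curve\<close>

text \<open>
  The span over K of the sequences of values u(P_0), u(P_1), ... of the elements u of A
  of degree below k. Sequences replace functions on the curve over K: the value u(P_m) is
  u^(2^m), so pairing with an additive polynomial in u only sees these sequences.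
\<close>

inductive_set evaluations :: "nat \<Rightarrow> (nat \<Rightarrow> function_field) set" for k where
  evaluations_zero: "(\<lambda>m. 0) \<in> evaluations k"
| evaluations_add: "u \<in> below k \<Longrightarrow> \<phi> \<in> evaluations k \<Longrightarrow>
    (\<lambda>m. c * to_fract u ^ 2^m + \<phi> m) \<in> evaluations k"

lemma evaluations_basis: "u \<in> below k \<Longrightarrow> (\<lambda>m. to_fract u ^ 2^m) \<in> evaluations k"
  using evaluations_add[OF _ evaluations_zero, of u k 1] by simp

lemma evaluations_plus:
  assumes "\<phi> \<in> evaluations k" "\<psi> \<in> evaluations k"
  shows "(\<lambda>m. \<phi> m + \<psi> m) \<in> evaluations k"
  using assms(1)
proof induction
  case (evaluations_add u \<phi> c)
  thus ?case using evaluations.evaluations_add[of u k _ c] by (simp add: add.assoc)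
qed (simp add: assms(2))

lemma evaluations_scale:
  assumes "\<phi> \<in> evaluations k" shows "(\<lambda>m. a * \<phi> m) \<in> evaluations k"
  using assms
proof induction
  case (evaluations_add u \<phi> c)
  thus ?case using evaluations.evaluations_add[of u k _ "a * c"]
    by (simp add: distrib_left mult.assoc)
qed (simp add: evaluations_zero)

lemma evaluations_mono:
  assumes "\<phi> \<in> evaluations k" "k \<le> l" shows "\<phi> \<in> evaluations l"
  using assms(1)
proof induction
  case (evaluations_add u \<phi> c)
  thus ?case using evaluations.evaluations_add below_mono[OF assms(2)] by blast
qed (rule evaluations_zero)

text \<open>
  The coordinate function X has a double pole at infinity.
\<close>

lemma evaluations_times_x_frob:
  assumes "\<phi> \<in> evaluations k" shows "(\<lambda>m. x_frob m * \<phi> m) \<in> evaluations (k + 2)"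
  using assms
proof induction
  case (evaluations_add u \<phi> c)
  have "(\<lambda>m. x_frob m * (c * to_fract u ^ 2^m + \<phi> m))
      = (\<lambda>m. c * to_fract (xA * u) ^ 2^m + x_frob m * \<phi> m)"
    by (simp add: x_frob_def power_mult_distrib distrib_left mult_ac)
  thus ?case
    using evaluations.evaluations_add[OF xA_times_below[OF evaluations_add(1)] evaluations_add(3)]
    by simp
qed (simp add: evaluations_zero)

text \<open>
  The sequence has the monomial of degree k as its leading term, with coefficient 1
  (a sum in place of a difference, in characteristic 2).
\<close>

definition monic_at :: "nat \<Rightarrow> (nat \<Rightarrow> function_field) \<Rightarrow> bool" where
  "monic_at k \<phi> \<longleftrightarrow> (\<lambda>m. to_fract (basis_elt k) ^ 2^m + \<phi> m) \<in> evaluations k"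

lemma monic_at_evaluations:
  assumes "monic_at k \<phi>" "k \<noteq> 1" shows "\<phi> \<in> evaluations (Suc k)"
proof -
  let ?t = "\<lambda>m. to_fract (basis_elt k) ^ 2^m"
  have "?t \<in> evaluations (Suc k)"
    using assms(2) by (rule evaluations_basis[OF basis_elt_below[OF lessI]])
  moreover have "(\<lambda>m. ?t m + \<phi> m) \<in> evaluations (Suc k)"
    using assms(1) unfolding monic_at_def by (rule evaluations_mono) simp
  ultimately have "(\<lambda>m. ?t m + (?t m + \<phi> m)) \<in> evaluations (Suc k)"
    by (rule evaluations_plus[of ?t _ "\<lambda>m. ?t m + \<phi> m"])
  thus ?thesis by (simp only: char2_cancel)
qed

text \<open>
  The values at P_m of the function W_n. The denominator of f_j vanishes at V_j and -V_j.
  Its own numerator also vanishes at -V_j; the numerator of f_(j-1), or for j = 0 the extra first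
  factor, vanishes at V_j. So the only pole is at infinity.
\<close>

definition shtuka_prod :: "nat \<Rightarrow> nat \<Rightarrow> function_field" where
  "shtuka_prod n m = (x_frob m + x_frob 0 + 1) * (\<Prod>j<n. shtuka j m)"

lemma shtuka_prod_recurrence:
  "shtuka_prod (Suc (Suc n)) m
    = (x_frob m + x_frob n) * shtuka_prod n m + (x_frob n + x_frob (Suc n)) * shtuka_prod (Suc n) m"
  unfolding shtuka_recurrence[of m n] shtuka_prod_def
  by (simp add: algebra_simps char2)

text \<open>
  The recurrence of the W_n multiplies by X + x_n and adds a multiple of the
  previous function, so that the pole order grows by exactly one in each step. This proves
  regularity away from infinity without any theory of divisors.
\<close>

lemma monic_shtuka_prod: "monic_at (n + 2) (shtuka_prod n)"
proof (induction n rule: exp_coeff.induct)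
  case 1
  have eq: "(\<lambda>m. to_fract (basis_elt (0 + 2)) ^ 2^m + shtuka_prod 0 m)
      = (\<lambda>m. (x_frob 0 + 1) * to_fract 1 ^ 2^m + 0)"
    by (simp add: basis_elt_def shtuka_prod_def x_frob_def add.assoc char2)
  have "1 \<in> below (0 + 2)" unfolding add_0 below_2 by simp
  thus ?case unfolding monic_at_def eq by (rule evaluations_add[OF _ evaluations_zero])
next
  case 2
  have xA: "basis_elt 2 = xA" "basis_elt (Suc 0 + 2) = yA" by (simp_all add: basis_elt_def)
  have "shtuka_prod (Suc 0) m = chord 0 m" for m
    using x_frob_sum_plus_1_nonzero[of m 0] by (simp add: shtuka_prod_def shtuka_def)
  hence eq: "(\<lambda>m. to_fract (basis_elt (Suc 0 + 2)) ^ 2^m + shtuka_prod (Suc 0) m)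
      = (\<lambda>m. x_frob 0 * to_fract xA ^ 2^m
          + ((y_frob 0 + x_frob 0 * x_frob 0) * to_fract 1 ^ 2^m + 0))"
    unfolding xA by (simp add: chord_def x_frob_def y_frob_def algebra_simps char2 del: power_Suc)
  have "xA \<in> below (Suc 0 + 2)" "1 \<in> below (Suc 0 + 2)"
    using basis_elt_below[of 2 "Suc 0 + 2"] below_2 below_mono[of 2 "Suc 0 + 2"] xA by auto
  thus ?case unfolding monic_at_def eq
    by (intro evaluations_add[OF _ evaluations_add[OF _ evaluations_zero]])
next
  case (3 n)
  let ?s = "\<lambda>k m. to_fract (basis_elt k) ^ 2^m"
  have x: "?s (n + 2 + 2) m = x_frob m * ?s (n + 2) m" for m
  proof -
    have "basis_elt (n + 2 + 2) = xA * basis_elt (n + 2)"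
    proof (cases "even n")
      case True
      then obtain i where "n = 2 * i" by blast
      thus ?thesis by (simp add: basis_elt_def)
    next
      case False
      then obtain i where "n = 2 * i + 1" by (rule oddE)
      thus ?thesis by (simp add: basis_elt_def mult_ac)
    qed
    thus ?thesis by (simp add: x_frob_def power_mult_distrib)
  qed
  have eq: "(\<lambda>m. ?s (n + 2 + 2) m + shtuka_prod (Suc (Suc n)) m)
      = (\<lambda>m. x_frob m * (?s (n + 2) m + shtuka_prod n m)
          + (x_frob n * shtuka_prod n m + (x_frob n + x_frob (Suc n)) * shtuka_prod (Suc n) m))"
    unfolding x shtuka_prod_recurrence by (simp add: algebra_simps)
  have "(\<lambda>m. x_frob m * (?s (n + 2) m + shtuka_prod n m)) \<in> evaluations (n + 2 + 2)"
    using 3(2) unfolding monic_at_def by (rule evaluations_times_x_frob)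
  moreover have "shtuka_prod n \<in> evaluations (n + 2 + 2)"
    "shtuka_prod (Suc n) \<in> evaluations (n + 2 + 2)"
    by (rule evaluations_mono[OF monic_at_evaluations[OF 3(2)]]; simp)
      (rule evaluations_mono[OF monic_at_evaluations[OF 3(1)]]; simp)
  ultimately have "(\<lambda>m. ?s (n + 2 + 2) m + shtuka_prod (Suc (Suc n)) m) \<in> evaluations (n + 2 + 2)"
    unfolding eq by (intro evaluations_plus evaluations_scale)
  thus ?case unfolding monic_at_def by simp
qed

definition scaled_exp_den :: "nat \<Rightarrow> function_field" where
  "scaled_exp_den n = exp_den n * (x_frob n + x_frob 0 + 1)"

text \<open>
  Let \<open>\<Lambda>\<close> pair a sequence with the coefficients of e = \<open>vanishing (n + 2)\<close>. On the values of
  an element u it gives e(u), so it kills the span of the elements of degree below n + 2. Since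
  W_n is the monomial of degree n + 2 modulo this span, \<open>\<Lambda>\<close> sends it to the degree product.
  On the other hand W_n vanishes at P_0, ..., P_(n-1), which leaves the two top coefficients
  of e.
\<close>

lemma deg_prod_pairing:
  "deg_prod (n + 2) = scaled_exp_den (Suc n) + subleading (Suc n) * scaled_exp_den n"
proof -
  obtain c where c: "vanishing (n + 2) w
     = w ^ 2^(Suc n) + subleading (Suc n) * w ^ 2^n + (\<Sum>j<n. c j * w ^ 2^j)" for w
    using vanishing_expansion by blast
  define \<Lambda> where "\<Lambda> = (\<lambda>\<phi>. \<phi> (Suc n) + subleading (Suc n) * \<phi> n + (\<Sum>j<n. c j * \<phi> j) :: function_field)"
  have vanishing: "\<Lambda> (\<lambda>m. w ^ 2^m) = vanishing (n + 2) w" for w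
    unfolding \<Lambda>_def c ..
  have linear: "\<Lambda> (\<lambda>m. a * \<phi> m + \<psi> m) = a * \<Lambda> \<phi> + \<Lambda> \<psi>" for a \<phi> \<psi>
    unfolding \<Lambda>_def by (simp add: algebra_simps sum.distrib sum_distrib_left)
  have null: "\<Lambda> \<phi> = 0" if "\<phi> \<in> evaluations (n + 2)" for \<phi>
    using that
  proof induction
    case (evaluations_add u \<phi> a)
    thus ?case by (simp add: linear vanishing vanishing_below)
  qed (simp add: \<Lambda>_def)
  have "vanishing (n + 2) (to_fract (basis_elt (n + 2))) + \<Lambda> (shtuka_prod n) = 0"
    using null[OF monic_shtuka_prod[unfolded monic_at_def]]
      linear[of 1 "\<lambda>m. to_fract (basis_elt (n + 2)) ^ 2^m"] by (simp add: vanishing)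
  hence "deg_prod (n + 2) = \<Lambda> (shtuka_prod n)"
    by (simp add: deg_prod_vanishing char2_eq_iff[of "vanishing _ _"])
  moreover have "shtuka_prod n j = 0" if "j < n" for j
    using that shtuka_self[of j] by (auto simp: shtuka_prod_def)
  moreover have "shtuka_prod n n = scaled_exp_den n"
    by (simp add: shtuka_prod_def scaled_exp_den_def exp_den_shtuka)
  moreover have "shtuka_prod n (Suc n) = scaled_exp_den (Suc n)"
    by (simp add: shtuka_prod_def scaled_exp_den_def exp_den_shtuka shtuka_next)
  ultimately show ?thesis by (simp add: \<Lambda>_def)
qed

text \<open>
  By the induction hypothesis the second term of \<open>deg_prod_pairing\<close> is the square of
  \<open>subleading (Suc n)\<close>. The recursion for \<open>subleading\<close> adds the same square, and the two
  cancel.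
\<close>

lemma subleading_eq_scaled_exp_den: "subleading (Suc n) = scaled_exp_den n"
proof (induction n)
  case 0
  show ?case by (simp add: subleading_def scaled_exp_den_def exp_den_shtuka char2)
next
  case (Suc n)
  have "subleading (Suc (Suc n)) = (subleading (Suc n))^2 + deg_prod (n + 2)"
    by (simp add: subleading_Suc)
  thus ?case unfolding deg_prod_pairing Suc
    by (simp add: power2_eq_square add_ac char2)
qed

lemma deg_prod_eq_scaled_exp_den: "deg_prod (n + 2) = scaled_exp_den (Suc n) + (scaled_exp_den n)^2"
  unfolding deg_prod_pairing subleading_eq_scaled_exp_den by (simp add: power2_eq_square)


section \<open>Polynomial relations along the Frobenius orbit\<close>

text \<open>
  With u = \<open>x_gap n\<close>, c = \<open>gap_const\<close> and p = \<open>chord 0 n\<close>, all that follows is computed in the ring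
  generated by u, c and p subject to the relation \<open>chord_0_square\<close>. Passing from n to n + 1
  replaces u by u^2 + c + 1 and p by p + u (u^2 + c) + c.
\<close>

definition x_gap :: "nat \<Rightarrow> function_field" where "x_gap n = x_frob n + x_frob 0"

definition gap_const :: function_field where "gap_const = x_frob 1 + x_frob 0 + 1"

lemma char2_numeral:
  "(numeral (Num.Bit0 n) :: function_field) = 0" "(numeral (Num.Bit1 n) :: function_field) = 1"
  by (simp_all add: numeral_Bit0 numeral_Bit1 two_function_field)

lemmas char2_expand = algebra_simps power2_eq_square power3_eq_cube char2 char2_numeral

lemma x_gap_0: "x_gap 0 = 0" by (simp add: x_gap_def char2)

lemma x_gap_Suc: "x_gap (Suc n) = (x_gap n)^2 + gap_const + 1"
  unfolding x_gap_def gap_const_def x_frob_Suc One_nat_def by (simp add: char2_expand)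

lemma x_gap_nonzero: "x_gap (Suc n) \<noteq> 0" "x_gap n + 1 \<noteq> 0"
  unfolding x_gap_def by (simp_all add: x_frob_sum_nonzero x_frob_sum_plus_1_nonzero)

lemma chord_0_0: "chord 0 0 = 0" by (simp add: chord_def char2)

lemma chord_0_Suc: "chord 0 (Suc n) = chord 0 n + x_gap n * ((x_gap n)^2 + gap_const) + gap_const"
proof -
  define X Y x y where "X = x_frob n" "Y = y_frob n" "x = x_frob 0" "y = y_frob 0"
  note XY = this
  have "y * y = y + x^3 + x + 1" "Y * Y = Y + X^3 + X + 1"
    using curve_frob[of 0] curve_frob[of n] by (simp_all add: XY power2_eq_square)
  thus ?thesis
    unfolding chord_def x_gap_def gap_const_def x_frob_Suc y_frob_Suc One_nat_def XY[symmetric]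
    by (simp add: char2_expand)
qed

lemma chord_0_square:
  "chord 0 n * chord 0 n = chord 0 n + x_gap n * (x_gap n + 1) * (x_gap n + gap_const)"
proof -
  have "x_frob n + x_frob (Suc 0) + 1 = x_gap n + gap_const"
    unfolding x_gap_def gap_const_def One_nat_def by (simp add: char2_expand)
  hence "chord 0 n * (chord 0 n + 1) = x_gap n * (x_gap n + 1) * (x_gap n + gap_const)"
    using chord_norm[of 0 n] by (simp add: x_gap_def)
  hence "chord 0 n * chord 0 n + chord 0 n = x_gap n * (x_gap n + 1) * (x_gap n + gap_const)"
    by (simp add: distrib_left)
  thus ?thesis by (metis add.commute char2_cancel)
qed

lemma chord_base: "chord n 0 = chord 0 n + (x_gap n)^2"
  using chord_swap[of n 0] by (simp add: x_gap_def add.commute)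

lemma chord_0_nonzero: "chord 0 (Suc n) \<noteq> 0"
  using chord_norm_nonzero[of "Suc n" 0] by auto

text \<open>
  In the polynomial identities below p' and u' are the values that belong to n + 1. Each is
  checked by expanding and eliminating the square of p, alone or inside a longer product.
\<close>

lemma exp_den_deg_prod_identity:
  fixes c p u :: function_field
  assumes "p * p = p + u * (u + 1) * (u + c)"
  shows "(p + u * (u^2 + c) + c) * (u^2 + p + 1) = (u + 1) * (u^2 + c) * (u^2 + u + p + 1)"
proof -
  have "p * (p * z) = (p + u * (u + 1) * (u + c)) * z" for z
    using assms by (simp flip: mult.assoc)
  note square = this assms
  show ?thesis by (simp add: char2_expand square)
qed

lemma deg_prod_square_identity:
  fixes c p u :: function_field
  assumes "p * p = p + u * (u + 1) * (u + c)"
  defines "p' \<equiv> p + u * (u^2 + c) + c"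
  shows "(u^2 + u + p + 1)^2 * (u^2 + c) = p' * (p' + u^2 + c + 1)"
proof -
  have "p * (p * z) = (p + u * (u + 1) * (u + c)) * z" for z
    using assms by (simp flip: mult.assoc)
  note square = this assms(1)
  show ?thesis unfolding p'_def by (simp add: char2_expand square)
qed

lemma log_step_identity:
  fixes c p u :: function_field
  assumes "p * p = p + u * (u + 1) * (u + c)"
  defines "p' \<equiv> p + u * (u^2 + c) + c" and "u' \<equiv> u^2 + c + 1"
  shows "(p + u) * (p' + c + 1) * (u' * (u' + 1))
    = u * (u^2 + u + p + 1) * (p + c + 1) * (p' + u'^2 + 1)"
proof -
  have "p * (p * z) = (p + u * (u + 1) * (u + c)) * z" for z
    using assms by (simp flip: mult.assoc)
  note square = this assms(1)
  show ?thesis unfolding p'_def u'_def by (simp add: char2_expand square)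
qed

text \<open>
  The line parallel to the one through P_0 that is measured by \<open>shifted_chord\<close> is tangent to E.
  This is its norm formula, whose last factor, X^2 + x + 1 at X = x_(n+1), reflects the
  tangency; it serves to show that \<open>shifted_chord\<close> does not vanish.
\<close>

lemma shifted_chord_norm_identity:
  fixes c p u :: function_field
  assumes "p * p = p + u * (u + 1) * (u + c)"
  defines "p' \<equiv> p + u * (u^2 + c) + c" and "u' \<equiv> u^2 + c + 1"
  shows "(p' + c + 1) * (p' + c) = u^2 * (u'^2 + c)"
proof -
  have "p * (p * z) = (p + u * (u + 1) * (u + c)) * z" for z
    using assms by (simp flip: mult.assoc)
  note square = this assms(1)
  show ?thesis unfolding p'_def u'_def by (simp add: char2_expand square)
qed


section \<open>Exponential denominators and degree products\<close>

lemma exp_den_Suc_cleared: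
  "exp_den (Suc n) * (x_gap (Suc n) + 1) = chord 0 (Suc n) * (exp_den n)^2"
  using x_gap_nonzero(2)[of "Suc n"] unfolding exp_den_Suc shtuka_def x_gap_def by simp

text \<open>
  Here D = d_n (u + 1) + (d_m (x_m + x + 1))^2 with n = m + 1. The second term is
  brought to the common factor d_n by d_n (u + 1) = p d_m^2 and the norm formula for p.
\<close>

lemma deg_prod_cleared:
  assumes "n \<ge> 1"
  shows "deg_prod (Suc n) * x_gap n = exp_den n * ((x_gap n)^2 + x_gap n + chord 0 n + 1)"
proof -
  obtain m where n: "n = Suc m" using assms by (metis Suc_le_D One_nat_def)
  let ?u = "x_gap n" and ?p = "chord 0 n" and ?d = "exp_den n"
  have "(x_gap m + 1)^2 = ?u + gap_const" unfolding n x_gap_Suc by (simp add: char2_expand)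
  hence g: "(scaled_exp_den m)^2 = (exp_den m)^2 * (?u + gap_const)"
    unfolding scaled_exp_den_def x_gap_def by (simp add: power_mult_distrib add.assoc)
  have "?p * ((scaled_exp_den m)^2 * ?u) = (?p * (exp_den m)^2) * ((?u + gap_const) * ?u)"
    unfolding g by (simp only: mult_ac)
  also have "\<dots> = ?d * (?u + 1) * ((?u + gap_const) * ?u)"
    unfolding n exp_den_Suc_cleared[symmetric] ..
  also have "\<dots> = ?d * (?p * ?p + ?p)"
    unfolding chord_0_square by (simp add: char2 mult_ac add_ac)
  also have "\<dots> = ?p * (?d * (?p + 1))" by (simp add: algebra_simps)
  finally have "(scaled_exp_den m)^2 * ?u = ?d * (?p + 1)"
    using chord_0_nonzero[of m] unfolding n by simp
  moreover have "scaled_exp_den n = ?d * (?u + 1)"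
    by (simp add: scaled_exp_den_def x_gap_def add.assoc)
  ultimately show ?thesis
    using deg_prod_eq_scaled_exp_den[of m] unfolding n by (simp add: algebra_simps power2_eq_square)
qed

lemma exp_den_deg_prod:
  assumes "n \<ge> 1"
  shows "exp_den (Suc n) * (exp_den n + deg_prod (Suc n))
    = deg_prod (Suc n) * exp_den n * subleading (Suc n)"
proof -
  let ?u = "x_gap n" and ?p = "chord 0 n" and ?d = "exp_den n" and ?D = "deg_prod (Suc n)"
  let ?v = "?u^2 + gap_const" and ?h = "?u^2 + ?u + ?p + 1"
  have nz: "?u \<noteq> 0" "?v \<noteq> 0"
    using assms x_gap_nonzero(1)[of "n - 1"] x_gap_nonzero(2)[of "Suc n"]
    by (simp_all add: x_gap_Suc add_ac char2)
  have d: "exp_den (Suc n) * ?v = (?p + ?u * ?v + gap_const) * ?d^2"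
    using exp_den_Suc_cleared[of n] unfolding x_gap_Suc chord_0_Suc by (simp add: add.assoc char2)
  have D: "?D * ?u = ?d * ?h" by (rule deg_prod_cleared[OF assms])
  have g: "subleading (Suc n) = ?d * (?u + 1)"
    by (simp add: subleading_eq_scaled_exp_den scaled_exp_den_def x_gap_def add.assoc)
  have "exp_den (Suc n) * (?d + ?D) * (?u * ?v) = (exp_den (Suc n) * ?v) * (?d * ?u + ?D * ?u)"
    by (simp add: algebra_simps)
  also have "\<dots> = ?d^3 * ((?p + ?u * ?v + gap_const) * (?u^2 + ?p + 1))"
  proof -
    have "?d * ?u + ?d * ?h = ?d * (?u^2 + ?p + 1)" by (simp add: char2_expand)
    thus ?thesis unfolding d D by (simp add: power2_eq_square power3_eq_cube mult_ac)
  qed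
  also have "\<dots> = ?d^3 * ((?u + 1) * ?v * ?h)"
    unfolding exp_den_deg_prod_identity[OF chord_0_square] ..
  also have "\<dots> = (?d * ?h) * ?d * (?d * (?u + 1)) * ?v"
    by (simp add: power3_eq_cube mult_ac)
  also have "\<dots> = ?D * ?d * subleading (Suc n) * (?u * ?v)"
    unfolding D[symmetric] g by (simp only: mult_ac)
  finally show ?thesis using nz by simp
qed


section \<open>Logarithm denominators and degree products\<close>

text \<open>
  By \<open>exp_den_plus_deg_prod_square\<close> this is, up to explicit factors, the sum d_k + D_k^2 in the
  third claim.
\<close>

definition shifted_chord :: "nat \<Rightarrow> function_field" where
  "shifted_chord k = chord 0 k + gap_const + 1"

lemma shifted_chord_nonzero:
  assumes "n \<ge> 1" shows "shifted_chord (Suc n) \<noteq> 0"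
proof -
  have "(x_gap (Suc n))^2 + gap_const = x_gap (Suc (Suc n)) + 1"
    unfolding x_gap_Suc[of "Suc n"] by (simp add: add.assoc char2)
  hence "(x_gap n)^2 * ((x_gap (Suc n))^2 + gap_const) \<noteq> 0"
    using assms x_gap_nonzero(1)[of "n - 1"] x_gap_nonzero(2)[of "Suc (Suc n)"] by simp
  thus ?thesis
    using shifted_chord_norm_identity[OF chord_0_square[of n]]
    unfolding shifted_chord_def chord_0_Suc[of n] x_gap_Suc[of n] by auto
qed

lemma deg_prod_square:
  assumes "n \<ge> 1"
  shows "(deg_prod (Suc n))^2 * (x_gap n)^2 = exp_den (Suc n) * (chord 0 (Suc n) + x_gap (Suc n))"
proof -
  let ?u = "x_gap n" and ?p = "chord 0 n" and ?d = "exp_den n" and ?D = "deg_prod (Suc n)"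
  let ?v = "?u^2 + gap_const"
  have nz: "?v \<noteq> 0"
    using x_gap_nonzero(2)[of "Suc n"] by (simp add: x_gap_Suc add_ac char2)
  have d: "exp_den (Suc n) * ?v = chord 0 (Suc n) * ?d^2"
    using exp_den_Suc_cleared[of n] unfolding x_gap_Suc by (simp add: add.assoc char2)
  have "?D^2 * ?u^2 * ?v = ?d^2 * ((?u^2 + ?u + ?p + 1)^2 * ?v)"
    using deg_prod_cleared[OF assms] by (simp add: mult.assoc flip: power_mult_distrib)
  also have "\<dots> = ?d^2 * (chord 0 (Suc n) * (chord 0 (Suc n) + x_gap (Suc n)))"
    unfolding deg_prod_square_identity[OF chord_0_square] chord_0_Suc x_gap_Suc
    by (simp add: add.assoc)
  also have "\<dots> = exp_den (Suc n) * (chord 0 (Suc n) + x_gap (Suc n)) * ?v"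
    using d by (simp add: mult_ac)
  finally show ?thesis using nz by simp
qed

lemma exp_den_plus_deg_prod_square:
  assumes "n \<ge> 1"
  shows "(exp_den (Suc n) + (deg_prod (Suc n))^2) * (x_gap n)^2
    = exp_den (Suc n) * shifted_chord (Suc n)"
  unfolding distrib_right deg_prod_square[OF assms] x_gap_Suc shifted_chord_def
  by (simp add: algebra_simps char2)

lemma log_ratio_cleared:
  "log_ratio (Suc n) * (x_gap (Suc n) * (x_gap (Suc n) + 1))
    = chord 0 (Suc n) + (x_gap (Suc n))^2 + 1"
  using x_gap_nonzero(1)[of n] x_gap_nonzero(2)[of "Suc n"]
  unfolding log_ratio_def chord_base[symmetric] x_gap_def[symmetric] by simp

lemma x_gap_1: "x_gap (Suc 0) = gap_const + 1"
  by (simp add: x_gap_Suc x_gap_0)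

lemma chord_0_1: "chord 0 (Suc 0) = gap_const"
  by (simp add: chord_0_Suc x_gap_0 chord_0_0)

lemma chord_0_2: "chord 0 (Suc (Suc 0)) = (gap_const + 1) * ((gap_const + 1)^2 + gap_const)"
  unfolding chord_0_Suc[of "Suc 0"] x_gap_1 chord_0_1 by (simp add: char2_expand)

lemma exp_den_1: "exp_den (Suc 0) = 1"
  by (simp add: exp_den_shtuka shtuka_next)

lemma deg_prod_2: "deg_prod 2 = gap_const + 1"
proof -
  have "deg_prod 2 * x_gap (Suc 0) = x_gap (Suc 0) * x_gap (Suc 0)"
    using deg_prod_cleared[of 1] exp_den_1
    by (simp add: numeral_2_eq_2 x_gap_1 chord_0_1 char2_expand)
  thus ?thesis using x_gap_nonzero(1)[of 0] x_gap_1 by simp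
qed

lemma exp_den_2: "exp_den 2 = gap_const + 1"
proof -
  have v: "x_gap (Suc (Suc 0)) + 1 = (gap_const + 1)^2 + gap_const"
    unfolding x_gap_Suc[of "Suc 0"] x_gap_1 by (simp add: add.assoc char2)
  have "exp_den 2 * (x_gap (Suc (Suc 0)) + 1) = (gap_const + 1) * (x_gap (Suc (Suc 0)) + 1)"
    using exp_den_Suc_cleared[of "Suc 0"] exp_den_1 unfolding v chord_0_2
    by (simp add: numeral_2_eq_2)
  thus ?thesis using x_gap_nonzero(2)[of "Suc (Suc 0)"] by simp
qed

text \<open>
  This is the third claim after eliminating d_k + D_k^2 in favour of \<open>shifted_chord k\<close>. In the
  induction step the new factor D_k is multiplied by the D_k that the induction hypothesis
  supplies, and \<open>deg_prod_square\<close> expresses D_k^2 through d_k. What remains relates d_k to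
  D_(k+1) and is \<open>log_step_identity\<close>.
\<close>

lemma prod_deg_prod_log_coeff:
  assumes "n \<ge> 1"
  shows "(\<Prod>i=2..n. deg_prod i) * shifted_chord (Suc n)
    = deg_prod (Suc n) * (x_gap n)^2 * (\<Prod>i=1..Suc n. log_ratio i)"
  using assms
proof (induction n rule: nat_induct_at_least)
  case base
  let ?c = gap_const and ?r = "log_ratio (Suc (Suc 0))"
  define w where "w = x_gap (Suc (Suc 0)) * (x_gap (Suc (Suc 0)) + 1)"
  have w: "w \<noteq> 0" unfolding w_def using x_gap_nonzero by simp
  have x2: "x_gap (Suc (Suc 0)) = ?c^2 + ?c"
    unfolding x_gap_Suc[of "Suc 0"] x_gap_1 by (simp add: char2_expand)
  have "shifted_chord (Suc (Suc 0)) * w = (?c + 1) * (?c + 1)^2 * (?r * w)"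
    unfolding w_def log_ratio_cleared[of "Suc 0"] unfolding x2 shifted_chord_def chord_0_2
    by (simp add: char2_expand)
  hence "shifted_chord (Suc (Suc 0)) = (?c + 1) * (?c + 1)^2 * ?r" using w by simp
  thus ?case using log_ratio_1 deg_prod_2 by (simp add: x_gap_1 numeral_2_eq_2)
next
  case (Suc n)
  let ?u = "x_gap (Suc n)" and ?p = "chord 0 (Suc n)" and ?d = "exp_den (Suc n)"
  let ?D = "deg_prod (Suc n)" and ?D' = "deg_prod (Suc (Suc n))"
  let ?T = "shifted_chord (Suc n)" and ?T' = "shifted_chord (Suc (Suc n))"
  let ?h = "?u^2 + ?u + ?p + 1" and ?r = "log_ratio (Suc (Suc n))"
  let ?Pi = "\<Prod>i=2..n. deg_prod i" and ?B = "\<Prod>i=1..Suc n. log_ratio i"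
  define w where "w = x_gap (Suc (Suc n)) * (x_gap (Suc (Suc n)) + 1)"
  have w: "w \<noteq> 0" unfolding w_def using x_gap_nonzero by simp
  have "(?p + ?u) * ?T' * w = ?u * ?h * ?T * (?r * w)"
    unfolding w_def log_ratio_cleared[of "Suc n"] shifted_chord_def
    unfolding x_gap_Suc[of "Suc n"] chord_0_Suc[of "Suc n"]
    by (rule log_step_identity[OF chord_0_square])
  hence C: "(?p + ?u) * ?T' = ?u * ?h * ?T * ?r" using w by simp
  have "?Pi * ?D * ?T' * ?T = ?D * ?T' * (?Pi * ?T)" by (simp only: mult_ac)
  also have "\<dots> = ?D^2 * (x_gap n)^2 * ?T' * ?B"
    unfolding Suc.IH by (simp only: mult_ac power2_eq_square)
  also have "\<dots> = ?d * ?B * ((?p + ?u) * ?T')"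
    unfolding deg_prod_square[OF Suc.hyps] by (simp only: mult_ac)
  also have "\<dots> = (?d * ?h) * ?u * ?B * ?r * ?T" unfolding C by (simp only: mult_ac)
  also have "\<dots> = ?D' * ?u^2 * (?B * ?r) * ?T"
    using deg_prod_cleared[of "Suc n"] by (simp add: mult_ac power2_eq_square)
  finally have "?Pi * ?D * ?T' = ?D' * ?u^2 * (?B * ?r)"
    using shifted_chord_nonzero[OF Suc.hyps] by simp
  thus ?case using Suc.hyps by (simp add: mult_ac)
qed

theorem theorem7p1:
  shows "(\<forall>k. rho_exp $ (2 ^ k) \<noteq> 0 \<and> rho_log $ (2 ^ k) \<noteq> 0)
    \<and> exp_den 2 = deg_prod 2
    \<and> (\<forall>k\<ge>2. exp_den (k - 1) + deg_prod k \<noteq> 0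
          \<and> exp_den k = deg_prod k * exp_den (k - 1) / (exp_den (k - 1) + deg_prod k)
              * (1 + (\<Sum>i=2..k. deg_prod i ^ 2 ^ (k - i))))
    \<and> (\<forall>k\<ge>2. (exp_den k + deg_prod k ^ 2) * (\<Prod>i=2..k - 1. deg_prod i) \<noteq> 0
          \<and> log_den k = deg_prod k * exp_den k
              / ((exp_den k + deg_prod k ^ 2) * (\<Prod>i=2..k - 1. deg_prod i)))"
proof (intro conjI allI impI)
  fix k
  show "rho_exp $ (2 ^ k) \<noteq> 0"
    using shtuka_nonzero[of k] by (simp add: rho_exp_nth)
  show "rho_log $ (2 ^ k) \<noteq> 0"
    using log_ratio_nonzero by (simp add: rho_log_nth_prod)
next
  show "exp_den 2 = deg_prod 2" unfolding exp_den_2 deg_prod_2 ..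
next
  fix k :: nat assume "k \<ge> 2"
  then obtain n where k: "k = Suc n" and n: "n \<ge> 1" by (cases k) auto
  have eq: "exp_den k * (exp_den (k - 1) + deg_prod k)
      = deg_prod k * exp_den (k - 1) * (1 + (\<Sum>i=2..k. deg_prod i ^ 2 ^ (k - i)))"
    using exp_den_deg_prod[OF n] unfolding k subleading_def by simp
  have "subleading k \<noteq> 0"
    unfolding k subleading_eq_scaled_exp_den scaled_exp_den_def
    using exp_den_nonzero x_frob_sum_plus_1_nonzero by simp
  hence "deg_prod k * exp_den (k - 1) * (1 + (\<Sum>i=2..k. deg_prod i ^ 2 ^ (k - i))) \<noteq> 0"
    using exp_den_nonzero deg_prod_nonzero unfolding subleading_def by simp
  thus nz: "exp_den (k - 1) + deg_prod k \<noteq> 0" unfolding eq[symmetric] by simp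
  show "exp_den k = deg_prod k * exp_den (k - 1) / (exp_den (k - 1) + deg_prod k)
              * (1 + (\<Sum>i=2..k. deg_prod i ^ 2 ^ (k - i)))"
    using eq nz by (metis nonzero_eq_divide_eq times_divide_eq_left)
next
  fix k :: nat assume "k \<ge> 2"
  then obtain n where k: "k = Suc n" and n: "n \<ge> 1" by (cases k) auto
  let ?S = "exp_den k + deg_prod k ^ 2" and ?Pi = "\<Prod>i=2..k - 1. deg_prod i"
  let ?B = "\<Prod>i=1..k. log_ratio i"
  have S: "?S * (x_gap n)^2 = exp_den k * shifted_chord k"
    using exp_den_plus_deg_prod_square[OF n] unfolding k .
  have u: "x_gap n \<noteq> 0" using n x_gap_nonzero(1)[of "n - 1"] by simp
  have B: "?B \<noteq> 0" using log_ratio_nonzero by simp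
  have "exp_den k * shifted_chord k \<noteq> 0"
    using exp_den_nonzero shifted_chord_nonzero[OF n] unfolding k by simp
  hence "?S \<noteq> 0" unfolding S[symmetric] by simp
  thus nz: "?S * ?Pi \<noteq> 0" using deg_prod_nonzero by simp
  have "?S * ?Pi * (x_gap n)^2 = exp_den k * (?Pi * shifted_chord k)"
    using S by (simp add: mult_ac)
  also have "\<dots> = deg_prod k * exp_den k * ?B * (x_gap n)^2"
    using prod_deg_prod_log_coeff[OF n] unfolding k by (simp add: mult_ac)
  finally have "?S * ?Pi = deg_prod k * exp_den k * ?B" using u by simp
  moreover have "log_den k = 1 / ?B" unfolding log_den_def rho_log_nth_prod ..
  ultimately show "log_den k = deg_prod k * exp_den k / (?S * ?Pi)"
    using nz B by (simp add: field_simps)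
qed

end
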